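(* Let $p>3$ be a prime. Then \begin{align*} &\sum_{n=0}^{p-1}\big(27(2n+1)^3+13(2n+1)\big)\frac{f_n^2}{(-8)^n}\equiv -8p^2+48p^4+96p^4(2^{p-1}-1)-7p^5B_{p-3}\pmod{p^6},\\ &\sum_{n=0}^{p-1}(2646n^3+5103n^2+3668n+940)f_n^2\\ &\qquad\equiv 32p^2(21p-10)8^{p-1}+196p^4\big(3+8(8^{p-1}-1)\big)-280p^5B_{p-3}\pmod{p^6},\\ &\sum_{n=0}^{p-1}(7938n^3+8505n^2+4200n+813)\frac{f_n^2}{64^n}\\ &\qquad\equiv 245p^4-392p^4(8^{p-1}-1)+4p^2(49p^2+63p+30)8^{1-p}+105p^5B_{p-3}\pmod{p^6}. \end{align*}
   Context: $f_n=\sum_{k=0}^n\binom nk^3$ are the Franel numbers. $\{B_n\}$ are the Bernoulli numbers given by $B_0=1$ and $\sum_{k=0}^{n-1}\binom nkB_k=0$ for $n\ge 2$. A congruence $\alpha\equiv\beta\pmod{p^m}$ between rational numbers with denominators prime to $p$ means that $(\alpha-\beta)/p^m$ is a rational number with denominator prime to $p$. *)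

theory Defs
  imports Complex_Main "HOL-Computational_Algebra.Primes"
begin

definition franel :: "nat \<Rightarrow> nat" where
  "franel n = (\<Sum>k=0..n. (n choose k) ^ 3)"

(* The relation sum_{k=0}^{n-1} (n choose k) B_k = 0 with n = m + 2, solved for its last term
   (n choose (n-1)) B_{n-1} = n B_{n-1}; see bernoulli_recurrence below.  In particular B_1 = -1/2. *)
fun bernoulli :: "nat \<Rightarrow> rat" where
  "bernoulli 0 = 1"
| "bernoulli (Suc m) = - (\<Sum>k\<le>m. of_nat (Suc (Suc m) choose k) * bernoulli k) / of_nat (Suc (Suc m))"

lemma bernoulli_recurrence:
  assumes "n \<ge> 2"
  shows "(\<Sum>k=0..n-1. of_nat (n choose k) * bernoulli k) = 0"
proof -
  obtain m where n: "n = Suc (Suc m)"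
    using assms by (metis add_2_eq_Suc le_Suc_ex)
  have "Suc (Suc m) choose Suc m = Suc (Suc m)"
    using binomial_symmetric[of "Suc m" "Suc (Suc m)"] by simp
  moreover have "(of_nat (Suc (Suc m)) :: rat) \<noteq> 0"
    by (simp only: of_nat_eq_0_iff)
  ultimately show ?thesis
    unfolding n by (simp add: atLeast0AtMost del: binomial_Suc_Suc of_nat_Suc)
qed

(* quotient_of returns the reduced fraction with positive denominator. *)
definition p_integral :: "nat \<Rightarrow> rat \<Rightarrow> bool" where
  "p_integral p x \<longleftrightarrow> coprime (snd (quotient_of x)) (int p)"

(* a is congruent to b modulo p^m; p-integrality of both sides is part of the meaning. *)
definition rat_cong :: "nat \<Rightarrow> nat \<Rightarrow> rat \<Rightarrow> rat \<Rightarrow> bool" where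
  "rat_cong p m a b \<longleftrightarrow>
     p_integral p a \<and> p_integral p b \<and> p_integral p ((a - b) / of_nat p ^ m)"

end

theory Submission
  imports Defs "HOL-Number_Theory.Residues" "HOL-Computational_Algebra.Formal_Power_Series"
begin

text \<open>
  Each of the three sums telescopes. By Franel's three-term recurrence, for suitable cubic
  weights w the sum of w(n) f_n^2 / m^n over n < N, multiplied by m^(N-1), is a quadratic form
  in f_N and f_(N-1): the squares carry the factor N^4 and the mixed product carries N^2
  (lemma franel_square_sum). At N = p these factors leave nothing to know beyond f_p and
  f_(p-1) modulo p^4, and the theorem comes down to

    f_p = 2 + p^3 B / 2   and   f_(p-1) = 8^(p-1) + 5/8 p^3 B   (mod p^4),   B = B_(p-3).

  The Bernoulli number comes from power sums. Let S be the sum of the n-th powers of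
  1, ..., p-1 for an even integer n. Splitting this range by parity and splitting it into two
  halves, and expanding (p - k)^n modulo p^2 both times, yields two linear relations between
  S, its part over odd numbers and the sum of (n-1)-st powers over even numbers (lemma
  even_power_sum). For n = p-3 Faulhaber's formula gives S = p B (mod p^2), hence the sum of
  the inverse cubes of the even numbers modulo p; for n = -2 the same relations then yield the
  sum of the inverse squares of the odd numbers modulo p^2.

  For f_p, write (p choose k) = p/k (p-1 choose k-1): apart from the two outer terms, the cubes
  contribute p^3 times an alternating sum of inverse cubes modulo p.

  For f_(p-1), put a_k = (-1)^k (p-1 choose k), which is the product of 1 - p/j over j \<le> k, so
  that f_(p-1) is the alternating sum of a_k^3. The alternating sums of 1, a_k and a_k^2 are known
  exactly. With the truncated logarithm L(x) = x - x^2/2 + x^3/3 there is the polynomial identity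

    a^3 = 11/2 - 9 a + 9/2 a^2 + 3 L(a - 1),

  so only the alternating sum of the L(a_k - 1) is missing. Modulo p^4, L turns the product a_k
  into the sum of the L(-p/j) over j \<le> k; in the alternating sum over k only the even j survive, and
  the result is L(d - 1) for d the product of 1 - p/(2i) over 2i < p. Finally d is the middle
  a_k divided by 2^(p-1), and also 2^(p-1) divided by the product of 1 - p^2/r^2 over odd r < p,
  which brings in the sum of inverse squares found before.
\<close>

section \<open>Franel numbers: recurrence and closed forms of the sums\<close>

text \<open>
  Zeilberger's method: for the summand (n choose k)^3 the recurrence holds up to a difference
  G(k+1) - G(k), where G is the summand times a rational function of n and k. Expressing all binomials through
  u(k) = (n+2 choose k) / ((n+1)(n+2)) avoids denominators; the polynomial R of the certificate is
  the solution of the linear system obtained by comparing coefficients.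
\<close>

lemma franel_recurrence:
  fixes n :: nat
  defines "N \<equiv> (of_nat n :: rat)"
  shows "(N + 2)^2 * of_nat (franel (n + 2))
       = (7 * (N + 1)^2 + 7 * (N + 1) + 2) * of_nat (franel (n + 1))
         + 8 * (N + 1)^2 * of_nat (franel n)"
proof -
  define u :: "nat \<Rightarrow> rat" where "u k = of_nat ((n + 2) choose k) / ((N + 1) * (N + 2))" for k
  define R :: "rat \<Rightarrow> rat" where
    "R k = 4 * (N + 1)^2 * k^3 - (18*N^3 + 66*N^2 + 78*N + 30) * k^2
       + (27*N^4 + 147*N^3 + 291*N^2 + 249*N + 78) * k
       - (14*N^5 + 102*N^4 + 290*N^3 + 402*N^2 + 272*N + 72)" for k
  have pos: "N + 1 > 0" "N + 2 > 0" by (simp_all add: N_def add_nonneg_pos)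
  have absorb: "(of_nat (Suc m) - of_nat k) * of_nat (Suc m choose k)
                  = (of_nat (Suc m) * of_nat (m choose k) :: rat)" if "k \<le> Suc m" for m k
    using arg_cong[OF binomial_absorb_comp[of "Suc m" k], of "of_nat :: nat \<Rightarrow> rat"] that
    by (simp add: distrib_right)
  have c2: "of_nat ((n + 2) choose k) = (N + 1) * (N + 2) * u k" for k
    using pos by (simp add: u_def)
  have c1: "of_nat ((n + 1) choose k) = (N + 1) * (N + 2 - of_nat k) * u k" if "k \<le> n + 2" for k
  proof -
    have "(N + 2) * of_nat ((n + 1) choose k) = (N + 2 - of_nat k) * of_nat ((n + 2) choose k)"
      using absorb[of k "n + 1"] that by (simp add: N_def add_ac)
    also have "\<dots> = (N + 2) * ((N + 1) * (N + 2 - of_nat k) * u k)"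
      unfolding c2 by simp
    finally show ?thesis using pos by simp
  qed
  have c0: "of_nat (n choose k) = (N + 1 - of_nat k) * (N + 2 - of_nat k) * u k"
    if "k \<le> n + 2" for k
  proof (cases "k = n + 2")
    case False
    then have "(N + 1) * of_nat (n choose k) = (N + 1 - of_nat k) * of_nat ((n + 1) choose k)"
      using absorb[of k n] that by (simp add: N_def add_ac)
    also have "\<dots> = (N + 1) * ((N + 1 - of_nat k) * (N + 2 - of_nat k) * u k)"
      using c1[OF that] by simp
    finally show ?thesis using pos by simp
  qed (simp add: N_def)
  have shift: "of_nat (Suc k) * u (Suc k) = (N + 2 - of_nat k) * u k" if "k \<le> n + 2" for k
  proof -
    have "of_nat (Suc k) * of_nat ((n + 2) choose Suc k) = ((N + 2) * of_nat ((n + 1) choose k) :: rat)"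
      using arg_cong[OF binomial_absorption[of k "n + 2"], of "of_nat :: nat \<Rightarrow> rat"]
      by (simp add: N_def add_ac distrib_right del: binomial_Suc_Suc)
    then have "((N + 1) * (N + 2)) * (of_nat (Suc k) * u (Suc k))
        = ((N + 1) * (N + 2)) * ((N + 2 - of_nat k) * u k)"
      unfolding c1[OF that] c2 by (simp only: mult_ac)
    moreover have "(N + 1) * (N + 2) \<noteq> 0" using pos by simp
    ultimately show ?thesis by (simp only: mult_cancel_left) simp
  qed
  have scale_cubes: "c1 * (x * t)^3 - c2 * (y * t)^3 - c3 * (z * t)^3 = (v * t)^3 * d - (w * t)^3 * e"
    if "c1 * x^3 - c2 * y^3 - c3 * z^3 = v^3 * d - w^3 * e" for c1 c2 c3 d e t v w x y z :: rat
    using arg_cong[OF that, of "\<lambda>r. r * t^3"]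
    by (simp only: power_mult_distrib left_diff_distrib right_diff_distrib mult_ac)
  define G where "G k = (of_nat k * u k)^3 * R (of_nat k)" for k
  have step: "(N + 2)^2 * of_nat ((n + 2) choose k)^3
        - (7 * (N + 1)^2 + 7 * (N + 1) + 2) * of_nat ((n + 1) choose k)^3
        - 8 * (N + 1)^2 * of_nat (n choose k)^3 = G (Suc k) - G k" if k: "k \<le> n + 2" for k
  proof -
    have "G (Suc k) = ((N + 2 - of_nat k) * u k)^3 * R (of_nat k + 1)"
      unfolding G_def shift[OF k] by (simp add: add.commute)
    moreover have "(N + 2)^2 * ((N + 1) * (N + 2))^3
        - (7 * (N + 1)^2 + 7 * (N + 1) + 2) * ((N + 1) * (N + 2 - of_nat k))^3
        - 8 * (N + 1)^2 * ((N + 1 - of_nat k) * (N + 2 - of_nat k))^3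
      = (N + 2 - of_nat k)^3 * R (of_nat k + 1) - of_nat k^3 * R (of_nat k)"
      by (simp add: R_def algebra_simps eval_nat_numeral)
    from scale_cubes[OF this, of "u k"]
    have "(N + 2)^2 * ((N + 1) * (N + 2) * u k)^3
        - (7 * (N + 1)^2 + 7 * (N + 1) + 2) * ((N + 1) * (N + 2 - of_nat k) * u k)^3
        - 8 * (N + 1)^2 * ((N + 1 - of_nat k) * (N + 2 - of_nat k) * u k)^3
      = ((N + 2 - of_nat k) * u k)^3 * R (of_nat k + 1) - (of_nat k * u k)^3 * R (of_nat k)"
      .
    ultimately show ?thesis
      unfolding c2 c1[OF k] c0[OF k] by (simp only: G_def)
  qed
  have ext: "of_nat (franel m) = (\<Sum>k\<le>n + 2. of_nat (m choose k)^3 :: rat)" if "m \<le> n + 2" for m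
  proof -
    have "(\<Sum>k\<le>n + 2. (m choose k)^3) = (\<Sum>k\<le>m. (m choose k)^3)"
      using that by (intro sum.mono_neutral_right) auto
    then show ?thesis
      by (simp add: franel_def atLeast0AtMost flip: of_nat_power of_nat_sum)
  qed
  have "(N + 2)^2 * of_nat (franel (n + 2))
        - (7 * (N + 1)^2 + 7 * (N + 1) + 2) * of_nat (franel (n + 1))
        - 8 * (N + 1)^2 * of_nat (franel n)
      = (\<Sum>k\<le>n + 2. (N + 2)^2 * of_nat ((n + 2) choose k)^3
          - (7 * (N + 1)^2 + 7 * (N + 1) + 2) * of_nat ((n + 1) choose k)^3
          - 8 * (N + 1)^2 * of_nat (n choose k)^3)"
    unfolding sum_subtractf sum_distrib_left[symmetric] by (simp only: ext)
  also have "\<dots> = (\<Sum>k\<le>n + 2. G (Suc k) - G k)"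
    by (intro sum.cong refl step) simp
  also have "\<dots> = G (Suc (n + 2)) - G 0"
    using sum_lessThan_telescope[of G "Suc (n + 2)"] by (simp only: lessThan_Suc_atMost)
  also have "\<dots> = 0" by (simp add: G_def u_def binomial_eq_0 del: binomial_Suc_Suc)
  finally show ?thesis by simp
qed

text \<open>
  The assumption is the induction step with f_N, f_(N-1) and (N+1)^2 f_(N+1) replaced by
  indeterminates: in the quadratic form at N+1 the new value occurs only in the combination
  (N+1)^2 f_(N+1), which the recurrence expresses through the old values. At N = 0 the assumption
  also contains the base case, because the coefficient of f_(-1) in the recurrence vanishes there.
\<close>

lemma franel_square_sum:
  fixes \<alpha> \<gamma> m :: rat and b w :: "rat \<Rightarrow> rat" and M :: nat
  assumes certificate: "\<And>N x y v. v = (7*N^2 + 7*N + 2) * x + 8*N^2 * y \<Longrightarrow>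
      m * (\<alpha> * N^4 * x^2 + N^2 * b N * x * y + \<gamma> * N^4 * y^2) + w N * x^2
      = \<alpha> * v^2 + b (N + 1) * v * x + \<gamma> * (N + 1)^4 * x^2"
    and "m \<noteq> 0"
  shows "(\<Sum>n\<le>M. w (of_nat n) * of_nat (franel n)^2 / m^n) * m^M
    = \<alpha> * of_nat (Suc M)^4 * of_nat (franel (Suc M))^2
      + of_nat (Suc M)^2 * b (of_nat (Suc M)) * of_nat (franel (Suc M)) * of_nat (franel M)
      + \<gamma> * of_nat (Suc M)^4 * of_nat (franel M)^2"
proof (induction M)
  case 0
  have "franel 0 = 1" "franel (Suc 0) = 2" by (simp_all add: franel_def)
  \<comment> \<open>The step identity at N = 0, where x = f_0 = 1 and v = f_1 = 2.\<close>
  then show ?case using certificate[of 2 0 1 0] by (simp add: algebra_simps)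
next
  case (Suc M)
  define N x y z where "N = (of_nat (Suc M) :: rat)" and "x = (of_nat (franel (Suc M)) :: rat)"
    and "y = (of_nat (franel M) :: rat)" and "z = (of_nat (franel (Suc (Suc M))) :: rat)"
  note defs = N_def x_def y_def z_def
  have N1: "of_nat (Suc (Suc M)) = N + 1" by (simp add: N_def)
  have "(N + 1)^2 * z = (7*N^2 + 7*N + 2) * x + 8*N^2 * y"
    using franel_recurrence[of M] by (simp add: defs add_ac)
  note certificate[OF this]
  moreover have "(\<Sum>n\<le>Suc M. w (of_nat n) * of_nat (franel n)^2 / m^n) * m^Suc M
     = m * (\<alpha> * N^4 * x^2 + N^2 * b N * x * y + \<gamma> * N^4 * y^2) + w N * x^2"
    using Suc.IH \<open>m \<noteq> 0\<close> by (simp add: defs distrib_right del: of_nat_Suc)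
  ultimately show ?case
    unfolding N1 by (simp add: power_mult_distrib x_def z_def power2_eq_square power4_eq_xxxx mult_ac)
qed

lemma franel_square_sum_minus_8:
  "(\<Sum>n\<le>M. (27 * (2 * of_nat n + 1)^3 + 13 * (2 * of_nat n + 1)) * of_nat (franel n)^2 / (-8)^n)
      * (-8)^M
    = (-8/3) * of_nat (Suc M)^4 * of_nat (franel (Suc M))^2
      + of_nat (Suc M)^2 * (-4 + 56/3 * of_nat (Suc M)^2) * of_nat (franel (Suc M)) * of_nat (franel M)
      + 64/3 * of_nat (Suc M)^4 * (of_nat (franel M)^2 :: rat)"
  by (rule franel_square_sum[where b = "\<lambda>N. -4 + 56/3 * N^2"
        and w = "\<lambda>N. 27 * (2 * N + 1)^3 + 13 * (2 * N + 1)"])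
     (simp_all add: power2_eq_square power3_eq_cube power4_eq_xxxx field_simps)

lemma franel_square_sum_1:
  "(\<Sum>n\<le>M. (2646 * of_nat n^3 + 5103 * of_nat n^2 + 3668 * of_nat n + 940) * of_nat (franel n)^2)
    = 49/3 * of_nat (Suc M)^4 * of_nat (franel (Suc M))^2
      + of_nat (Suc M)^2 * (-160 + 336 * of_nat (Suc M) - 784/3 * of_nat (Suc M)^2)
          * of_nat (franel (Suc M)) * of_nat (franel M)
      + 3136/3 * of_nat (Suc M)^4 * (of_nat (franel M)^2 :: rat)"
  using franel_square_sum[where M = M and m = 1 and \<alpha> = "49/3" and \<gamma> = "3136/3"
        and b = "\<lambda>N. -160 + 336 * N - 784/3 * N^2"
        and w = "\<lambda>N. 2646 * N^3 + 5103 * N^2 + 3668 * N + 940"]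
  by (simp add: power2_eq_square power3_eq_cube power4_eq_xxxx field_simps)

lemma franel_square_sum_64:
  "(\<Sum>n\<le>M. (7938 * of_nat n^3 + 8505 * of_nat n^2 + 4200 * of_nat n + 813)
      * of_nat (franel n)^2 / 64^n) * 64^M
    = 49 * of_nat (Suc M)^4 * of_nat (franel (Suc M))^2
      + of_nat (Suc M)^2 * (60 + 126 * of_nat (Suc M) + 98 * of_nat (Suc M)^2)
          * of_nat (franel (Suc M)) * of_nat (franel M)
      + 49 * of_nat (Suc M)^4 * (of_nat (franel M)^2 :: rat)"
  by (rule franel_square_sum[where b = "\<lambda>N. 60 + 126 * N + 98 * N^2"
        and w = "\<lambda>N. 7938 * N^3 + 8505 * N^2 + 4200 * N + 813"])
     (simp_all add: power2_eq_square power3_eq_cube power4_eq_xxxx field_simps)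

section \<open>Congruences between rationals modulo powers of a prime\<close>

text \<open>
  The half h of p - 1 is a parameter of its own, so that the equation p = 2 * h + 1 can be used for rewriting.
\<close>

locale prime_gt_3 =
  fixes p h :: nat
  assumes prime: "prime p" and gt_3: "p > 3" and p_eq: "p = 2 * h + 1"
begin

abbreviation P :: rat where "P \<equiv> of_nat p"

abbreviation integral :: "rat \<Rightarrow> bool" where "integral \<equiv> p_integral p"

text \<open>
  Here any representation as a fraction is admitted, while the definition of p-integrality refers
  to the reduced one; this makes the closure properties immediate.
\<close>

lemma integral_iff: "integral x \<longleftrightarrow> (\<exists>a b. x = of_int a / of_int b \<and> \<not> int p dvd b)"
proof
  assume x: "integral x"
  obtain a b where ab: "quotient_of x = (a, b)" by force
  then have "coprime b (int p)" using x by (simp add: p_integral_def)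
  then have "\<not> int p dvd b"
    using prime by (metis coprime_absorb_right not_prime_unit prime_nat_int_transfer)
  then show "\<exists>a b. x = of_int a / of_int b \<and> \<not> int p dvd b"
    using quotient_of_div[OF ab] by blast
next
  assume "\<exists>a b. x = of_int a / of_int b \<and> \<not> int p dvd b"
  then obtain a b where x: "x = of_int a / of_int b" and b: "\<not> int p dvd b" by blast
  obtain c d where cd: "quotient_of x = (c, d)" by force
  have "d > 0" "coprime c d" using quotient_of_denom_pos[OF cd] quotient_of_coprime[OF cd] by auto
  have "b \<noteq> 0" using b by auto
  have "of_int a * of_int d = (of_int c * of_int b :: rat)"
    using x quotient_of_div[OF cd] \<open>b \<noteq> 0\<close> \<open>d > 0\<close> by (simp add: field_simps)
  then have "a * d = c * b" by (metis of_int_eq_iff of_int_mult)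
  then have "d dvd b" using \<open>coprime c d\<close>
    by (metis coprime_commute coprime_dvd_mult_right_iff dvd_triv_right)
  then have "\<not> int p dvd d" using b dvd_trans by blast
  then have "coprime d (int p)"
    using prime by (metis coprime_commute prime_imp_coprime prime_nat_int_transfer)
  then show "integral x" by (simp add: p_integral_def cd)
qed

lemma integral_of_int [simp, intro]: "integral (of_int a)"
proof -
  have "\<not> int p dvd 1" using gt_3 by auto
  then show ?thesis unfolding integral_iff by (intro exI[of _ a] exI[of _ 1]) simp
qed

lemma integral_of_nat [simp, intro]: "integral (of_nat a)"
  using integral_of_int[of "int a"] by simp

lemma integral_numeral [simp, intro]: "integral (numeral a)"
  using integral_of_nat[of "numeral a"] by simp

lemma integral_0 [simp, intro]: "integral 0" and integral_1 [simp, intro]: "integral 1"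
  using integral_of_nat[of 0] integral_of_nat[of 1] by simp_all

lemma integral_add [simp, intro]:
  assumes "integral x" "integral y" shows "integral (x + y)"
proof -
  obtain a b c d where x: "x = of_int a / of_int b" "\<not> int p dvd b"
    and y: "y = of_int c / of_int d" "\<not> int p dvd d"
    using assms unfolding integral_iff by blast
  have "\<not> int p dvd b * d"
    using x y prime by (simp add: prime_dvd_mult_iff)
  moreover have "x + y = of_int (a * d + c * b) / of_int (b * d)"
    using x y by (cases "b = 0"; cases "d = 0") (auto simp: add_frac_eq)
  ultimately show ?thesis unfolding integral_iff by blast
qed

lemma integral_mult [simp, intro]:
  assumes "integral x" "integral y" shows "integral (x * y)"
proof -
  obtain a b c d where x: "x = of_int a / of_int b" "\<not> int p dvd b"
    and y: "y = of_int c / of_int d" "\<not> int p dvd d"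
    using assms unfolding integral_iff by blast
  have "\<not> int p dvd b * d"
    using x y prime by (simp add: prime_dvd_mult_iff)
  moreover have "x * y = of_int (a * c) / of_int (b * d)"
    using x y by simp
  ultimately show ?thesis unfolding integral_iff by blast
qed

lemma integral_minus [simp, intro]: "integral x \<Longrightarrow> integral (- x)"
  using integral_mult[OF integral_of_int[of "-1"], of x] by simp

lemma integral_diff [simp, intro]: "integral x \<Longrightarrow> integral y \<Longrightarrow> integral (x - y)"
  using integral_add[of x "- y"] by simp

lemma integral_power [simp, intro]: "integral x \<Longrightarrow> integral (x ^ n)"
  by (induction n) auto

lemma integral_sum [intro]: "(\<And>i. i \<in> A \<Longrightarrow> integral (f i)) \<Longrightarrow> integral (sum f A)"
  by (induction A rule: infinite_finite_induct) auto

lemma integral_inverse_of_nat: "\<not> p dvd k \<Longrightarrow> integral (inverse (of_nat k))"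
  unfolding integral_iff by (intro exI[of _ 1] exI[of _ "int k"]) (simp add: field_simps)

lemma integral_half [simp, intro]: "integral (1 / 2)"
  and integral_third [simp, intro]: "integral (1 / 3)"
proof -
  have "\<not> p dvd 2" "\<not> p dvd 3" using gt_3 by (auto dest: dvd_imp_le)
  from this[THEN integral_inverse_of_nat] show "integral (1 / 2)" "integral (1 / 3)"
    by (simp_all add: inverse_eq_divide)
qed

lemma integral_divide_numeral [simp, intro]:
  assumes "integral x"
  shows "integral (x / 2)" "integral (x / 3)" "integral (x / 4)" "integral (x / 8)" "integral (x / 12)"
    "integral (x / 16)"
proof -
  have "x / 2 = x * (1 / 2)" "x / 3 = x * (1 / 3)" "x / 4 = x * ((1 / 2) * (1 / 2))"
    "x / 8 = x * ((1 / 2) * ((1 / 2) * (1 / 2)))" "x / 12 = x * ((1 / 2) * ((1 / 2) * (1 / 3)))"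
    "x / 16 = x * ((1 / 2) * ((1 / 2) * ((1 / 2) * (1 / 2))))"
    by simp_all
  then show "integral (x / 2)" "integral (x / 3)" "integral (x / 4)" "integral (x / 8)" "integral (x / 12)"
    "integral (x / 16)"
    using assms by (metis integral_mult integral_half integral_third)+
qed

definition p_unit :: "rat \<Rightarrow> bool" where
  "p_unit x \<longleftrightarrow> x \<noteq> 0 \<and> integral x \<and> integral (inverse x)"

lemma p_unit_of_nat: "\<not> p dvd k \<Longrightarrow> p_unit (of_nat k)"
  unfolding p_unit_def using integral_inverse_of_nat[of k] by (cases "k = 0") auto

lemma p_unit_less: "0 < k \<Longrightarrow> k < p \<Longrightarrow> p_unit (of_nat k)"
  by (intro p_unit_of_nat) (auto dest: dvd_imp_le)

lemma p_unit_diff: "0 < k \<Longrightarrow> k < p \<Longrightarrow> p_unit (P - of_nat k)"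
  using p_unit_less[of "p - k"] by (simp add: of_nat_diff)

lemma p_unit_minus: "p_unit x \<Longrightarrow> p_unit (- x)"
  by (auto simp: p_unit_def)

lemma p_unit_2: "p_unit 2"
  by (simp add: p_unit_def)

lemma p_unit_power: "p_unit x \<Longrightarrow> p_unit (x ^ n)"
  by (auto simp: p_unit_def power_inverse[symmetric])

lemma integral_power_int: "p_unit x \<Longrightarrow> integral (x powi n)"
  unfolding power_int_def p_unit_def by auto

lemma p_unit_8_power: "p_unit (8 ^ n)"
  using p_unit_power[OF p_unit_power[OF p_unit_2, of 3], of n] by simp

lemma p_unit_imp_nonzero: "p_unit x \<Longrightarrow> x \<noteq> 0"
  and p_unit_imp_integral: "p_unit x \<Longrightarrow> integral x"
  and p_unit_imp_inverse: "p_unit x \<Longrightarrow> integral (inverse x)"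
  by (simp_all add: p_unit_def)

definition pcong :: "rat \<Rightarrow> nat \<Rightarrow> rat \<Rightarrow> bool" ("(_ \<simeq>\<^bsub>_\<^esub> _)" [51, 0, 51] 50) where
  "a \<simeq>\<^bsub>m\<^esub> b \<longleftrightarrow> integral ((a - b) / P ^ m)"

lemma P_nonzero [simp]: "p \<noteq> 0" "p > 0"
  using gt_3 by auto

lemma pcong_iff: "a \<simeq>\<^bsub>m\<^esub> b \<longleftrightarrow> (\<exists>c. integral c \<and> a = b + P ^ m * c)"
proof
  assume "a \<simeq>\<^bsub>m\<^esub> b"
  then show "\<exists>c. integral c \<and> a = b + P ^ m * c"
    unfolding pcong_def by (intro exI[of _ "(a - b) / P ^ m"]) simp
qed (auto simp: pcong_def)

lemma pcongI: "a = b + P ^ m * c \<Longrightarrow> integral c \<Longrightarrow> a \<simeq>\<^bsub>m\<^esub> b"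
  unfolding pcong_iff by blast

lemma pcongE:
  assumes "a \<simeq>\<^bsub>m\<^esub> b" obtains c where "integral c" "a = b + P ^ m * c"
  using assms unfolding pcong_iff by blast

lemma pcong_refl [simp, intro]: "a \<simeq>\<^bsub>m\<^esub> a"
  by (simp add: pcong_def)

lemma pcong_sym: "a \<simeq>\<^bsub>m\<^esub> b \<Longrightarrow> b \<simeq>\<^bsub>m\<^esub> a"
  using integral_minus[of "(a - b) / P ^ m"] by (simp add: pcong_def minus_divide_left)

lemma pcong_add: "a \<simeq>\<^bsub>m\<^esub> b \<Longrightarrow> c \<simeq>\<^bsub>m\<^esub> d \<Longrightarrow> a + c \<simeq>\<^bsub>m\<^esub> b + d"
  using integral_add[of "(a - b) / P ^ m" "(c - d) / P ^ m"]
  by (simp add: pcong_def add_diff_add flip: add_divide_distrib)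

lemma pcong_minus: "a \<simeq>\<^bsub>m\<^esub> b \<Longrightarrow> - a \<simeq>\<^bsub>m\<^esub> - b"
  using integral_minus[of "(a - b) / P ^ m"] by (simp add: pcong_def minus_divide_left)

lemma pcong_diff: "a \<simeq>\<^bsub>m\<^esub> b \<Longrightarrow> c \<simeq>\<^bsub>m\<^esub> d \<Longrightarrow> a - c \<simeq>\<^bsub>m\<^esub> b - d"
  using pcong_add[of a m b "- c" "- d"] pcong_minus by simp

lemma pcong_trans [trans]: "a \<simeq>\<^bsub>m\<^esub> b \<Longrightarrow> b \<simeq>\<^bsub>m\<^esub> c \<Longrightarrow> a \<simeq>\<^bsub>m\<^esub> c"
  using pcong_add[of a m b b c] pcong_diff[of "a + b" m "b + c" b b] by simp

text \<open>
  These let calculations mix congruences with equations without higher-order unification.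
\<close>

lemma pcong_eq_trans [trans]: "a \<simeq>\<^bsub>m\<^esub> b \<Longrightarrow> b = c \<Longrightarrow> a \<simeq>\<^bsub>m\<^esub> c"
  and eq_pcong_trans [trans]: "a = b \<Longrightarrow> b \<simeq>\<^bsub>m\<^esub> c \<Longrightarrow> a \<simeq>\<^bsub>m\<^esub> c"
  by simp_all

lemma pcong_mult_left: "integral c \<Longrightarrow> a \<simeq>\<^bsub>m\<^esub> b \<Longrightarrow> c * a \<simeq>\<^bsub>m\<^esub> c * b"
  using integral_mult[of c "(a - b) / P ^ m"] by (simp add: pcong_def algebra_simps)

lemma pcong_integral: "a \<simeq>\<^bsub>m\<^esub> b \<Longrightarrow> integral b \<Longrightarrow> integral a"
  unfolding pcong_iff by auto

lemma pcong_mult: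
  assumes "a \<simeq>\<^bsub>m\<^esub> b" "c \<simeq>\<^bsub>m\<^esub> d" "integral b" "integral d"
  shows "a * c \<simeq>\<^bsub>m\<^esub> b * d"
proof -
  have "a * c \<simeq>\<^bsub>m\<^esub> a * d"
    using assms by (intro pcong_mult_left pcong_integral[OF assms(1)])
  also have "a * d \<simeq>\<^bsub>m\<^esub> b * d"
    using pcong_mult_left[OF assms(4,1)] by (simp add: mult.commute)
  finally show ?thesis .
qed

lemma pcong_power: "a \<simeq>\<^bsub>m\<^esub> b \<Longrightarrow> integral b \<Longrightarrow> a ^ n \<simeq>\<^bsub>m\<^esub> b ^ n"
  by (induction n) (auto intro: pcong_mult)

lemma pcong_sum: "(\<And>i. i \<in> A \<Longrightarrow> f i \<simeq>\<^bsub>m\<^esub> g i) \<Longrightarrow> sum f A \<simeq>\<^bsub>m\<^esub> sum g A"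
  by (induction A rule: infinite_finite_induct) (auto intro: pcong_add)

lemma pcong_weaken:
  assumes "a \<simeq>\<^bsub>n\<^esub> b" "m \<le> n"
  shows "a \<simeq>\<^bsub>m\<^esub> b"
proof -
  obtain c where "integral c" "a = b + P ^ n * c" using assms pcongE by blast
  then show ?thesis
    using assms(2) by (intro pcongI[of _ _ _ "P ^ (n - m) * c"]) (auto simp flip: power_add mult.assoc)
qed

lemma pcong_scale: "P ^ j * a \<simeq>\<^bsub>j + m\<^esub> P ^ j * b \<longleftrightarrow> a \<simeq>\<^bsub>m\<^esub> b"
  by (simp add: pcong_def power_add flip: right_diff_distrib)

lemma pcong_scaleI: "a \<simeq>\<^bsub>m\<^esub> b \<Longrightarrow> n = j + m \<Longrightarrow> P ^ j * a \<simeq>\<^bsub>n\<^esub> P ^ j * b"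
  by (simp add: pcong_scale)

lemma pcong_scale_P: "P * a \<simeq>\<^bsub>2\<^esub> P * b \<longleftrightarrow> a \<simeq>\<^bsub>1\<^esub> b"
  using pcong_scale[of 1 a 1 b] by (simp add: numeral_2_eq_2)

lemma pcong_cancel:
  assumes "p_unit u" "u * a \<simeq>\<^bsub>m\<^esub> u * b"
  shows "a \<simeq>\<^bsub>m\<^esub> b"
  using pcong_mult_left[OF p_unit_imp_inverse[OF assms(1)] assms(2)] p_unit_imp_nonzero[OF assms(1)]
  by (simp flip: mult.assoc)

lemma fermat:
  assumes "\<not> p dvd k"
  shows "of_nat k ^ (p - 1) \<simeq>\<^bsub>1\<^esub> 1"
proof -
  have "[int k ^ (p - 1) = 1] (mod int p)"
    using fermat_theorem[OF prime assms] cong_int_iff[of "k ^ (p - 1)" 1 p] by simp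
  then have "int p dvd int k ^ (p - 1) - 1" by (simp add: cong_iff_dvd_diff)
  then obtain c where "int k ^ (p - 1) - 1 = int p * c" by auto
  then have "of_int (int k ^ (p - 1) - 1) = (of_int (int p * c) :: rat)" by simp
  then show ?thesis by (intro pcongI[of _ _ _ "of_int c"]) (simp_all add: algebra_simps)
qed

lemma fermat_2: "2 ^ (p - 1) \<simeq>\<^bsub>1\<^esub> 1"
proof -
  have "\<not> p dvd 2" using gt_3 by (auto dest: dvd_imp_le)
  from fermat[OF this] show ?thesis by simp
qed

text \<open>
  The binomial expansion up to the linear term, for exponents of either sign: the step from i to i + 1
  multiplies by x + p, the step from i to i - 1 cancels this unit.
\<close>

lemma power_int_add_P:
  assumes "p_unit x" "p_unit (x + P)"
  shows "(x + P) powi n \<simeq>\<^bsub>2\<^esub> x powi n + of_int n * P * x powi (n - 1)"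
proof (induction n rule: int_induct[where k = 0])
  case base
  then show ?case by simp
next
  case (step1 i)
  have nz: "x \<noteq> 0" "x + P \<noteq> 0" using assms by (auto dest: p_unit_imp_nonzero)
  obtain c where c: "integral c"
    "(x + P) powi i = x powi i + of_int i * P * x powi (i - 1) + P^2 * c"
    using step1(2) pcongE by blast
  have "x powi i = x powi (i - 1) * x" using nz by (simp add: power_int_diff)
  then have "(x + P) powi (i + 1)
      = x powi (i + 1) + of_int (i + 1) * P * x powi (i + 1 - 1) + P^2 * (of_int i * x powi (i - 1) + c * (x + P))"
    using nz by (simp add: power_int_add c(2) algebra_simps power2_eq_square)
  then show ?case
    using assms c(1) by (intro pcongI) (assumption, auto simp: integral_power_int p_unit_imp_integral)
next
  case (step2 i)
  have nz: "x \<noteq> 0" "x + P \<noteq> 0" using assms by (auto dest: p_unit_imp_nonzero)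
  obtain c where c: "integral c"
    "(x + P) powi i = x powi i + of_int i * P * x powi (i - 1) + P^2 * c"
    using step2(2) pcongE by blast
  define y where "y = x powi (i - 2)"
  have y: "x powi (i - 1) = y * x" "x powi i = y * x^2"
    using nz by (simp_all add: y_def power_int_diff power2_eq_square field_simps)
  have y': "x powi (i - 1 - 1) = y" by (simp add: y_def)
  have "(x + P) * (x + P) powi (i - 1) = (x + P) powi i"
    using nz by (simp add: power_int_diff)
  also have "\<dots> = (x + P) * (x powi (i - 1) + of_int (i - 1) * P * y) + P^2 * (c - of_int (i - 1) * y)"
    unfolding c(2) y by (simp add: algebra_simps power2_eq_square)
  finally have eq: "(x + P) * (x + P) powi (i - 1)
      = (x + P) * (x powi (i - 1) + of_int (i - 1) * P * y) + P^2 * (c - of_int (i - 1) * y)" .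
  have "integral (c - of_int (i - 1) * y)"
    using assms(1) c(1) unfolding y_def by (intro integral_diff integral_mult integral_power_int) auto
  note pcongI[OF eq this]
  then show ?case unfolding y' by (rule pcong_cancel[OF assms(2)])
qed

text \<open>
  Reflecting k to p - k, the symmetry behind all relations between the power sums below.
\<close>

lemma power_int_P_minus:
  assumes "even n" "0 < k" "k < p"
  shows "(P - of_nat k) powi n \<simeq>\<^bsub>2\<^esub> of_nat k powi n - of_int n * P * of_nat k powi (n - 1)"
  using power_int_add_P[of "- of_nat k" n] assms p_unit_minus[OF p_unit_less[of k]] p_unit_diff[of k]
  by (simp add: power_int_minus_left)

end

section \<open>Power sums and Bernoulli numbers\<close>

lemma sum_split_parity:
  fixes g :: "nat \<Rightarrow> 'a :: comm_monoid_add"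
  shows "(\<Sum>k=1..2*h. g k) = (\<Sum>i=1..h. g (2*i)) + (\<Sum>i=1..h. g (2*h + 1 - 2*i))"
proof -
  have "(\<Sum>k=1..2*h. g k) = (\<Sum>i=1..h. g (2*i)) + (\<Sum>i=1..h. g (2*i - 1))"
    by (induction h) (simp_all add: ac_simps)
  also have "(\<Sum>i=1..h. g (2*i - 1)) = (\<Sum>i=1..h. g (2*h + 1 - 2*i))"
    by (rule sum.reindex_bij_witness[where i = "\<lambda>i. h + 1 - i" and j = "\<lambda>i. h + 1 - i"])
       (auto intro!: arg_cong[where f = g])
  finally show ?thesis .
qed

lemma sum_split_halves:
  fixes g :: "nat \<Rightarrow> 'a :: comm_monoid_add"
  shows "(\<Sum>k=1..2*h. g k) = (\<Sum>i=1..h. g i) + (\<Sum>i=1..h. g (2*h + 1 - i))"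
proof -
  have "(\<Sum>k=1..2*h. g k) = (\<Sum>i=1..h. g i) + (\<Sum>k=h+1..h+h. g k)"
    using sum.ub_add_nat[of 1 h g h] by (simp add: mult_2)
  also have "(\<Sum>k=h+1..h+h. g k) = (\<Sum>i=1..h. g (2*h + 1 - i))"
    by (rule sum.reindex_bij_witness[where i = "\<lambda>i. 2*h + 1 - i" and j = "\<lambda>i. 2*h + 1 - i"])
       auto
  finally show ?thesis .
qed

lemma sum_binomial_bernoulli:
  "(\<Sum>k\<le>n. of_nat (n choose k) * bernoulli k) = bernoulli n + (if n = 1 then 1 else 0)"
proof (cases n)
  case (Suc m)
  then show ?thesis
    using bernoulli_recurrence[of n] by (cases m) (simp_all add: atLeast0AtMost)
qed simp

text \<open>
  The difference equation of the Bernoulli polynomials: the coefficient of x^j on the left is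
  (N choose j) times a sum of the form treated in the preceding lemma, with N = n + 1.
\<close>

lemma sum_binomial_bernoulli_add_1:
  fixes x :: rat
  shows "(\<Sum>k\<le>Suc n. of_nat (Suc n choose k) * bernoulli k * (x + 1)^(Suc n - k))
    = (\<Sum>k\<le>Suc n. of_nat (Suc n choose k) * bernoulli k * x^(Suc n - k)) + of_nat (Suc n) * x^n"
proof -
  define N where "N = Suc n"
  have "(\<Sum>k\<le>N. of_nat (N choose k) * bernoulli k * (x + 1)^(N - k))
      = (\<Sum>k\<le>N. \<Sum>j\<le>N - k. of_nat (N choose k) * bernoulli k * (of_nat (N - k choose j) * x^j))"
    by (simp add: binomial_ring sum_distrib_left)
  also have "\<dots> = (\<Sum>j\<le>N. \<Sum>k\<le>N - j. of_nat (N choose k) * bernoulli k * (of_nat (N - k choose j) * x^j))"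
    by (subst (1 2) sum.Sigma; (intro ballI finite_atMost)?)
       (auto intro!: sum.reindex_bij_witness[where i = "\<lambda>(a, b). (b, a)" and j = "\<lambda>(a, b). (b, a)"])
  also have "\<dots> = (\<Sum>j\<le>N. of_nat (N choose j) * x^j * (\<Sum>k\<le>N - j. of_nat (N - j choose k) * bernoulli k))"
    unfolding sum_distrib_left
  proof (intro sum.cong refl)
    fix j k assume jk: "j \<in> {..N}" "k \<in> {..N - j}"
    have "(N choose k) * (N - k choose j) = (N choose j) * (N - j choose k)"
      using choose_mult[of j "j + k" N] choose_mult[of k "j + k" N] jk
      by (simp add: binomial_symmetric[of j "j + k"] mult.commute)
    from arg_cong[OF this, of "of_nat :: nat \<Rightarrow> rat"]
    show "of_nat (N choose k) * bernoulli k * (of_nat (N - k choose j) * x^j)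
        = of_nat (N choose j) * x^j * (of_nat (N - j choose k) * bernoulli k)"
      by (simp add: algebra_simps)
  qed
  also have "\<dots> = (\<Sum>j\<le>N. of_nat (N choose j) * x^j * bernoulli (N - j))
      + (\<Sum>j\<le>N. of_nat (N choose j) * x^j * (if j = n then 1 else 0))"
    unfolding sum_binomial_bernoulli sum.distrib[symmetric]
    by (intro sum.cong refl) (auto simp: N_def algebra_simps)
  also have "(\<Sum>j\<le>N. of_nat (N choose j) * x^j * (if j = n then 1 else 0)) = of_nat N * x^n"
    by (simp add: if_distrib N_def cong: if_cong)
  also have "(\<Sum>j\<le>N. of_nat (N choose j) * x^j * bernoulli (N - j))
      = (\<Sum>k\<le>N. of_nat (N choose k) * bernoulli k * x^(N - k))"
    by (rule sum.reindex_bij_witness[where i = "\<lambda>k. N - k" and j = "\<lambda>k. N - k"])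
       (auto simp: binomial_symmetric[symmetric])
  finally show ?thesis by (simp add: N_def)
qed

text \<open>
  Faulhaber's formula, by telescoping the difference equation of the Bernoulli polynomial.
\<close>

lemma power_sum_bernoulli:
  "of_nat (Suc n) * (\<Sum>k<N. of_nat k^n)
    = (\<Sum>k\<le>n. of_nat (Suc n choose k) * bernoulli k * of_nat N^(Suc n - k))"
proof -
  define \<beta> where "\<beta> x = (\<Sum>k\<le>Suc n. of_nat (Suc n choose k) * bernoulli k * x^(Suc n - k))" for x :: rat
  have diff: "\<beta> (of_nat (Suc k)) - \<beta> (of_nat k) = of_nat (Suc n) * of_nat k^n" for k
    using sum_binomial_bernoulli_add_1[of n "of_nat k"] unfolding \<beta>_def
    by (simp add: add.commute del: sum.atMost_Suc binomial_Suc_Suc)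
  have "of_nat (Suc n) * (\<Sum>k<N. of_nat k^n) = (\<Sum>k<N. \<beta> (of_nat (Suc k)) - \<beta> (of_nat k))"
    unfolding sum_distrib_left diff ..
  also have "\<dots> = \<beta> (of_nat N) - \<beta> 0"
    using sum_lessThan_telescope[of "\<lambda>k. \<beta> (of_nat k)" N] by simp
  also have "\<dots> = (\<Sum>k\<le>n. of_nat (Suc n choose k) * bernoulli k * of_nat N^(Suc n - k))"
    by (simp add: \<beta>_def power_0_left Suc_diff_le)
  finally show ?thesis .
qed

context prime_gt_3 begin

text \<open>
  Below p - 1 the defining recurrence divides only by numbers smaller than p.
\<close>

lemma integral_bernoulli: "n < p - 1 \<Longrightarrow> integral (bernoulli n)"
proof (induction n rule: less_induct)
  case (less n)
  show ?case
  proof (cases n)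
    case (Suc m)
    have "\<not> p dvd Suc (Suc m)" using less.prems Suc by (auto dest: dvd_imp_le)
    moreover have "integral (- (\<Sum>k\<le>m. of_nat (Suc (Suc m) choose k) * bernoulli k))"
      using less Suc by (intro integral_minus integral_sum integral_mult) auto
    ultimately show ?thesis
      using integral_mult[OF _ integral_inverse_of_nat] by (simp only: Suc bernoulli.simps divide_inverse)
  qed simp
qed

text \<open>
  In Faulhaber's formula at p every summand except the last one contains p^2.
\<close>

lemma power_sum_cong_bernoulli:
  assumes "0 < n" "n < p - 1"
  shows "(\<Sum>k=1..p-1. of_nat k^n) \<simeq>\<^bsub>2\<^esub> P * bernoulli n"
proof -
  obtain m where m: "n = Suc m" using assms by (cases n) auto
  define r where "r = (\<Sum>k\<le>m. of_nat (Suc n choose k) * bernoulli k * P^(m - k))"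
  have "(\<Sum>k<p. of_nat k^n :: rat) = (\<Sum>k=1..p-1. of_nat k^n)"
    using assms by (intro sum.mono_neutral_right) (auto simp: power_0_left)
  moreover have "(\<Sum>k\<le>m. of_nat (Suc n choose k) * bernoulli k * P^(Suc n - k)) = P^2 * r"
    unfolding r_def sum_distrib_left
    by (intro sum.cong refl) (auto simp: m Suc_diff_le power2_eq_square)
  ultimately have "of_nat (Suc n) * (\<Sum>k=1..p-1. of_nat k^n)
      = of_nat (Suc n) * (P * bernoulli n) + P^2 * r"
    using power_sum_bernoulli[of n p] by (simp add: m del: of_nat_Suc)
  moreover have "integral r"
    unfolding r_def using assms m by (intro integral_sum integral_mult integral_bernoulli) auto
  ultimately have "of_nat (Suc n) * (\<Sum>k=1..p-1. of_nat k^n)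
      \<simeq>\<^bsub>2\<^esub> of_nat (Suc n) * (P * bernoulli n)" by (rule pcongI)
  moreover have "p_unit (of_nat (Suc n))" using assms by (intro p_unit_less) auto
  ultimately show ?thesis using pcong_cancel by blast
qed

definition evens :: "int \<Rightarrow> rat" where "evens n = (\<Sum>i=1..h. of_nat (2*i) powi n)"
text \<open>
  These are the odd numbers below p, listed as the reflections of the even ones.
\<close>

definition odds :: "int \<Rightarrow> rat" where "odds n = (\<Sum>i=1..h. (P - of_nat (2*i)) powi n)"

text \<open>
  Pairing 2i with p - 2i and pairing i with p - i both exhaust 1, ..., p - 1. With e_n = evens n the
  first pairing gives S = 2 e_n - n p e_(n-1) and the second one, multiplied by 2^n, gives
  2^n S = 2 e_n - 2 n p e_(n-1), both modulo p^2. Eliminating e_n, or p e_(n-1), proves the two claims.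
\<close>

lemma even_power_sum:
  assumes "even n"
  defines "S \<equiv> (\<Sum>k=1..p-1. of_nat k powi n)"
  shows "2 powi n * S \<simeq>\<^bsub>2\<^esub> 2 * odds n"
    and "(1 - 2 powi n) * S \<simeq>\<^bsub>2\<^esub> of_int n * P * evens (n - 1)"
proof -
  have p: "p - 1 = 2*h" using p_eq by simp
  have S: "S = evens n + odds n"
    unfolding S_def p sum_split_parity evens_def odds_def
    by (intro arg_cong2[where f = "(+)"] sum.cong refl) (auto simp: p_eq of_nat_diff)
  have "odds n \<simeq>\<^bsub>2\<^esub> (\<Sum>i=1..h. of_nat (2*i) powi n - of_int n * P * of_nat (2*i) powi (n - 1))"
    unfolding odds_def using assms(1) p_eq by (intro pcong_sum power_int_P_minus) auto
  also have "\<dots> = evens n - of_int n * P * evens (n - 1)"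
    by (simp add: evens_def sum_subtractf sum_distrib_left)
  finally obtain c1 where c1: "integral c1" "odds n = evens n - of_int n * P * evens (n - 1) + P^2 * c1"
    by (rule pcongE)
  define H where "H n = (\<Sum>i=1..h. of_nat i powi n :: rat)" for n
  have "S = H n + (\<Sum>i=1..h. (P - of_nat i) powi n)"
    unfolding S_def p sum_split_halves H_def
    by (intro arg_cong2[where f = "(+)"] sum.cong refl) (auto simp: p_eq of_nat_diff)
  also have "\<dots> \<simeq>\<^bsub>2\<^esub> H n + (\<Sum>i=1..h. of_nat i powi n - of_int n * P * of_nat i powi (n - 1))"
    using assms(1) p_eq by (intro pcong_add pcong_refl pcong_sum power_int_P_minus) auto
  also have "\<dots> = 2 * H n - of_int n * P * H (n - 1)"
    by (simp add: H_def sum_subtractf sum_distrib_left)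
  finally have "2 powi n * S \<simeq>\<^bsub>2\<^esub> 2 powi n * (2 * H n - of_int n * P * H (n - 1))"
    using p_unit_2 by (intro pcong_mult_left integral_power_int)
  also have "\<dots> = 2 * evens n - 2 * of_int n * P * evens (n - 1)"
  proof -
    have "2 powi n * H n = evens n" "2 powi (n - 1) * H (n - 1) = evens (n - 1)"
      unfolding H_def evens_def sum_distrib_left
      by (simp_all add: power_int_mult_distrib)
    moreover have "2 powi n = 2 * (2 powi (n - 1) :: rat)" by (simp add: power_int_diff)
    ultimately show ?thesis by (simp add: algebra_simps)
  qed
  finally obtain c2 where c2: "integral c2"
    "2 powi n * S = 2 * evens n - 2 * of_int n * P * evens (n - 1) + P^2 * c2"
    by (rule pcongE)
  have "2 powi n * S = 2 * odds n + P^2 * (c2 - 2 * c1)"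
    unfolding c1 c2 by (simp add: algebra_simps)
  then show "2 powi n * S \<simeq>\<^bsub>2\<^esub> 2 * odds n" by (rule pcongI) (use c1 c2 in auto)
  have "(1 - 2 powi n) * S = of_int n * P * evens (n - 1) + P^2 * (c1 - c2)"
    using c1(2) c2(2) by (simp add: S algebra_simps)
  then show "(1 - 2 powi n) * S \<simeq>\<^bsub>2\<^esub> of_int n * P * evens (n - 1)"
    by (rule pcongI) (use c1 c2 in auto)
qed

text \<open>
  The exponent p - 3 is the one for which the power sum involves the wanted Bernoulli number, and
  modulo p the exponents p - 4 and -3 are interchangeable by Fermat's theorem.
\<close>

lemma evens_minus_3: "evens (-3) \<simeq>\<^bsub>1\<^esub> - bernoulli (p - 3) / 4"
proof -
  define n :: int where "n = int (p - 3)"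
  define B where "B = bernoulli (p - 3)"
  have "integral B" using integral_bernoulli[of "p - 3"] gt_3 by (simp add: B_def)
  have "p - 3 = 2 * (h - 1)" using p_eq by simp
  then have "even n" by (simp add: n_def)
  have n: "n = int (p - 1) - 2" "n = int p - 3" using gt_3 by (simp_all add: n_def of_nat_diff)
  have two: "integral (2 powi n)" using p_unit_2 by (rule integral_power_int)
  have "(\<Sum>k=1..p-1. of_nat k powi n) \<simeq>\<^bsub>2\<^esub> P * B"
    using power_sum_cong_bernoulli[of "p - 3"] gt_3 unfolding n_def B_def power_int_of_nat by simp
  then have "(1 - 2 powi n) * (P * B) \<simeq>\<^bsub>2\<^esub> (1 - 2 powi n) * (\<Sum>k=1..p-1. of_nat k powi n)"
    using two by (intro pcong_mult_left[OF _ pcong_sym]) auto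
  also note even_power_sum(2)[OF \<open>even n\<close>]
  finally have "P * ((1 - 2 powi n) * B) \<simeq>\<^bsub>2\<^esub> P * (of_int n * evens (n - 1))"
    by (simp add: mult_ac)
  then have 1: "(1 - 2 powi n) * B \<simeq>\<^bsub>1\<^esub> of_int n * evens (n - 1)"
    unfolding pcong_scale_P .
  have "evens (n - 1) \<simeq>\<^bsub>1\<^esub> evens (-3)"
    unfolding evens_def
  proof (rule pcong_sum)
    fix i assume "i \<in> {1..h}"
    then have i: "0 < 2 * i" "2 * i < p" using p_eq by auto
    then have unit: "p_unit (of_nat (2*i))" by (rule p_unit_less)
    have "\<not> p dvd 2 * i" using i by (auto dest: dvd_imp_le)
    note pcong_mult_left[OF integral_power_int[OF unit, of "-3"] fermat[OF this]]
    moreover have "n - 1 = -3 + int (p - 1)" by (simp add: n)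
    then have "of_nat (2*i) powi - 3 * of_nat (2*i) ^ (p - 1) = (of_nat (2*i) powi (n - 1) :: rat)"
      using p_unit_imp_nonzero[OF unit] by (simp only: power_int_add power_int_of_nat simp_thms)
    ultimately show "of_nat (2*i) powi (n - 1) \<simeq>\<^bsub>1\<^esub> of_nat (2*i) powi - 3"
      by (simp only: mult_1_right)
  qed
  moreover have "integral (evens (-3))"
    unfolding evens_def using p_eq by (intro integral_sum integral_power_int p_unit_less) auto
  moreover have "of_int n \<simeq>\<^bsub>1\<^esub> - 3"
    by (rule pcongI[of _ _ _ 1]) (simp_all add: n(2))
  ultimately have "of_int n * evens (n - 1) \<simeq>\<^bsub>1\<^esub> - 3 * evens (-3)"
    by (intro pcong_mult) auto
  with 1 have "(1 - 2 powi n) * B \<simeq>\<^bsub>1\<^esub> - 3 * evens (-3)" by (rule pcong_trans)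
  then have "4 * ((1 - 2 powi n) * B) \<simeq>\<^bsub>1\<^esub> 4 * (- 3 * evens (-3))"
    by (intro pcong_mult_left) auto
  then have 2: "4 * (- 3 * evens (-3)) \<simeq>\<^bsub>1\<^esub> 4 * ((1 - 2 powi n) * B)" by (rule pcong_sym)
  have "4 * 2 powi n = (2 ^ (p - 1) :: rat)"
    unfolding n(1) by (subst power_int_diff) auto
  then have "4 * ((1 - 2 powi n) * B) = 4 * B - B * 2 ^ (p - 1)"
    by (simp add: algebra_simps)
  also have "\<dots> \<simeq>\<^bsub>1\<^esub> 4 * B - B * 1"
    using fermat_2 \<open>integral B\<close> by (intro pcong_diff pcong_refl pcong_mult_left)
  finally have "4 * ((1 - 2 powi n) * B) \<simeq>\<^bsub>1\<^esub> 3 * B" by simp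
  with 2 have "4 * (- 3 * evens (-3)) \<simeq>\<^bsub>1\<^esub> 3 * B" by (rule pcong_trans)
  from pcong_mult_left[OF _ this, of "- 1 / 12"]
  show ?thesis by (simp add: B_def)
qed

text \<open>
  Both relations of even_power_sum at n = -2: the second one yields the full sum of inverse squares
  from the sum just computed, the first one its odd part.
\<close>

lemma odds_minus_2: "odds (-2) \<simeq>\<^bsub>2\<^esub> P * bernoulli (p - 3) / 12"
proof -
  define S where "S = (\<Sum>k=1..p-1. of_nat k powi (-2) :: rat)"
  have "1/4 * S \<simeq>\<^bsub>2\<^esub> 2 * odds (-2)" and *: "3/4 * S \<simeq>\<^bsub>2\<^esub> - 2 * P * evens (-3)"
    using even_power_sum[of "-2", folded S_def] by (simp_all add: power_int_minus)
  then have "3/2 * (2 * odds (-2)) \<simeq>\<^bsub>2\<^esub> 3/2 * (1/4 * S)"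
    by (intro pcong_mult_left[OF _ pcong_sym]) auto
  then have "3 * odds (-2) \<simeq>\<^bsub>2\<^esub> 1/2 * (3/4 * S)" by simp
  also have "\<dots> \<simeq>\<^bsub>2\<^esub> 1/2 * (- 2 * P * evens (-3))"
    using * by (intro pcong_mult_left) auto
  also have "\<dots> = - (P * evens (-3))" by simp
  also have "\<dots> \<simeq>\<^bsub>2\<^esub> - (P * (- bernoulli (p - 3) / 4))"
    by (intro pcong_minus) (simp only: pcong_scale_P evens_minus_3)
  finally have "3 * odds (-2) \<simeq>\<^bsub>2\<^esub> P * bernoulli (p - 3) / 4" by simp
  from pcong_mult_left[OF _ this, of "1/3"] show ?thesis by simp
qed

end

section \<open>Binomial sums and products\<close>

lemma eight_power_eq_cube: "(8::rat) ^ n = (2 ^ n)^3"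
  by (simp add: power_mult[symmetric] mult.commute[of _ 3]) (simp add: power_mult)

text \<open>
  For x = p this writes (p-1 choose k), up to sign, as a product of factors that are 1 modulo p.
\<close>

lemma gbinomial_minus_1_prod:
  fixes x :: "'a :: field_char_0"
  shows "(x - 1) gchoose k = (-1)^k * (\<Prod>j=1..k. 1 - x / of_nat j)"
proof (induction k)
  case (Suc k)
  have "of_nat (Suc k) * ((x - 1) gchoose Suc k) = (x - 1 - of_nat k) * ((x - 1) gchoose k)"
    using gbinomial_mult_1[of "x - 1" k] by (simp add: algebra_simps)
  then have "(x - 1) gchoose Suc k = (x - of_nat (Suc k)) / of_nat (Suc k) * ((x - 1) gchoose k)"
    by (simp add: field_simps del: of_nat_Suc) (simp add: algebra_simps)
  also have "(x - of_nat (Suc k)) / of_nat (Suc k) = - (1 - x / of_nat (Suc k))"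
    by (simp add: diff_divide_distrib del: of_nat_Suc)
  finally show ?case unfolding Suc.IH by (simp add: algebra_simps del: of_nat_Suc)
qed simp

text \<open>
  Compare the coefficients of X^(2n) in (1 - X^2)^(2n) = (1 - X)^(2n) (1 + X)^(2n).
\<close>

lemma alternating_sum_choose_squared:
  "(\<Sum>k\<le>2*n. (-1)^k * of_nat (2*n choose k)^2) = (-1)^n * (of_nat (2*n choose n) :: rat)"
proof -
  have nth: "fps_nth ((1 + fps_const c * fps_X ^ d) ^ N) (d * j) = of_nat (N choose j) * c ^ j"
    if "d > 0" for c :: rat and d N j
  proof -
    have "(1 + fps_const c * fps_X ^ d) ^ N
        = (\<Sum>k\<le>N. of_nat (N choose k) * (fps_const c * fps_X ^ d) ^ k)"
      by (subst add.commute, subst binomial_ring) simp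
    also have "\<dots> = (\<Sum>k\<le>N. fps_const (of_nat (N choose k) * c ^ k) * fps_X ^ (d * k))"
      by (simp add: power_mult_distrib power_mult fps_of_nat[symmetric] mult.assoc[symmetric]
               flip: fps_const_power fps_const_mult)
    finally have "fps_nth ((1 + fps_const c * fps_X ^ d) ^ N) (d * j)
        = (\<Sum>k\<le>N. if j = k then of_nat (N choose k) * c ^ k else 0)"
      using that by (simp add: fps_sum_nth if_distrib cong: if_cong)
    then show ?thesis by (auto simp: binomial_eq_0)
  qed
  have "(1 + fps_const (-1) * fps_X ^ 2) ^ (2*n)
      = (1 + fps_const (-1) * fps_X ^ 1) ^ (2*n) * (1 + fps_const 1 * fps_X ^ 1 :: rat fps) ^ (2*n)"
    by (simp add: power_mult_distrib[symmetric] algebra_simps power2_eq_square flip: fps_const_neg)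
  from arg_cong[OF this, of "\<lambda>F. fps_nth F (2*n)"]
  have "of_nat (2*n choose n) * (-1)^n
      = (\<Sum>k\<le>2*n. of_nat (2*n choose k) * (-1)^k * of_nat (2*n choose (2*n - k)) :: rat)"
    using nth[where d = 2 and N = "2*n" and c = "-1" and j = n]
      nth[where d = 1 and N = "2*n" and c = "-1"] nth[where d = 1 and N = "2*n" and c = 1]
    by (simp add: fps_mult_nth atLeast0AtMost)
  also have "\<dots> = (\<Sum>k\<le>2*n. (-1)^k * of_nat (2*n choose k)^2)"
    by (intro sum.cong refl) (auto simp: power2_eq_square mult_ac binomial_symmetric[symmetric])
  finally show ?thesis by (simp add: mult.commute)
qed

lemma central_binomial_prod:
  "of_nat (2*n choose n) = (4::rat)^n * (\<Prod>i=1..n. of_nat (2*i - 1) / of_nat (2*i))"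
proof (induction n)
  case (Suc n)
  have "Suc n * (2 * Suc n choose Suc n) = 2 * Suc n * (Suc (2*n) choose n)"
    using binomial_absorption[of n "2 * Suc n"] by simp
  moreover have "(Suc (2*n) choose n) * Suc n = Suc (2*n) * (2*n choose n)"
    using binomial_absorb_comp[of "Suc (2*n)" n] by (simp add: mult.commute)
  ultimately have "Suc n * (2 * Suc n choose Suc n) = 2 * Suc (2*n) * (2*n choose n)"
    by (simp only: mult_ac)
  from arg_cong[OF this, of "of_nat :: nat \<Rightarrow> rat"]
  have "of_nat (Suc n) * of_nat (2 * Suc n choose Suc n)
      = (2 * of_nat (Suc (2*n)) * of_nat (2*n choose n) :: rat)"
    by (simp only: of_nat_mult of_nat_numeral)
  moreover have "of_nat (Suc n) \<noteq> (0 :: rat)" by (simp only: of_nat_eq_0_iff)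
  ultimately have "of_nat (2 * Suc n choose Suc n)
      = (4 * (of_nat (Suc (2*n)) / of_nat (2 * Suc n)) * of_nat (2*n choose n) :: rat)"
    using of_nat_mult[of 2 "Suc n", where 'a = rat]
    by (simp add: field_simps del: of_nat_Suc of_nat_mult binomial_Suc_Suc mult_Suc_right)
  also have "of_nat (Suc (2*n)) / of_nat (2 * Suc n)
      = (of_nat (2 * Suc n - 1) / of_nat (2 * Suc n) :: rat)" by simp
  finally show ?case
    unfolding Suc.IH by (simp only: prod.nat_ivl_Suc' power_Suc mult_ac)
qed simp

text \<open>
  The term g j is counted with the signs of k = j, ..., 2n, which cancel unless j is even.
\<close>

lemma alternating_sum_partial_sums:
  fixes g :: "nat \<Rightarrow> rat"
  shows "(\<Sum>k\<le>2*n. (-1)^k * (\<Sum>j=1..k. g j)) = (\<Sum>i=1..n. g (2*i))"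
  by (induction n) (simp_all add: algebra_simps)

section \<open>The Franel numbers at p and p - 1\<close>

context prime_gt_3 begin

text \<open>
  The number (-1)^k (p-1 choose k), which is what the Franel number at p - 1 is built from, as the
  product that shows it to be 1 modulo p.
\<close>

definition alt_choose :: "nat \<Rightarrow> rat" where "alt_choose k = (\<Prod>j=1..k. 1 - P / of_nat j)"

lemma choose_eq_alt_choose: "of_nat ((p - 1) choose k) = (-1)^k * alt_choose k"
  using gbinomial_minus_1_prod[of P k] gt_3
  by (simp add: alt_choose_def binomial_gbinomial of_nat_diff)

lemma pcong_prod_1:
  assumes "\<And>i. i \<in> I \<Longrightarrow> x i \<simeq>\<^bsub>m\<^esub> 1"
  shows "prod x I \<simeq>\<^bsub>m\<^esub> 1"
  using assms
proof (induction I rule: infinite_finite_induct)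
  case (insert i I)
  then show ?case using pcong_mult[of "x i" m 1 "prod x I" 1] by simp
qed auto

lemma P_div_pcong_0: "0 < j \<Longrightarrow> j < p \<Longrightarrow> P / of_nat j \<simeq>\<^bsub>1\<^esub> 0"
  by (rule pcongI[of _ _ _ "inverse (of_nat j)"])
     (auto simp: divide_inverse intro!: integral_inverse_of_nat dest: dvd_imp_le)

lemma alt_choose_pcong_1: "k < p \<Longrightarrow> alt_choose k \<simeq>\<^bsub>1\<^esub> 1"
  unfolding alt_choose_def using pcong_diff[OF pcong_refl[of 1] P_div_pcong_0]
  by (intro pcong_prod_1) simp

text \<open>
  The outer terms contribute 2, and the others p^3 times the sum of -(-1)^k / k^3 modulo p. This last sum is
  twice its part over the even k, since k and p - k have different parity and opposite cubes.
\<close>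

lemma franel_p: "of_nat (franel p) \<simeq>\<^bsub>4\<^esub> 2 + P^3 * (bernoulli (p - 3) / 2)"
proof -
  have units: "p_unit (of_nat (2*i))" "p_unit (P - of_nat (2*i))" if "i \<in> {1..h}" for i
    by ((rule p_unit_less p_unit_diff; use that p_eq in simp)+)
  have odd_term: "(P - of_nat (2*i)) powi -3 \<simeq>\<^bsub>1\<^esub> - (of_nat (2*i) powi -3)" if i: "i \<in> {1..h}" for i
  proof -
    define x :: rat where "x = - of_nat (2*i)"
    have x: "p_unit x" "p_unit (x + P)"
      using units[OF i] p_unit_minus by (simp_all add: x_def)
    have "(x + P) powi -3 \<simeq>\<^bsub>1\<^esub> x powi -3 + of_int (-3) * P * x powi (-3 - 1)"
      by (rule pcong_weaken[OF power_int_add_P[OF x]]) simp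
    also have "\<dots> \<simeq>\<^bsub>1\<^esub> x powi -3"
      by (rule pcongI[of _ _ _ "of_int (-3) * x powi (-3 - 1)"])
         (auto intro!: integral_mult integral_power_int x simp: mult_ac)
    finally show ?thesis by (simp add: x_def power_int_minus_left)
  qed
  define t where "t k = (-1)^k * (of_nat k powi -3 :: rat)" for k :: nat
  have "(\<Sum>k=1..p-1. t k) = evens (-3) - (\<Sum>i=1..h. (P - of_nat (2*i)) powi -3)"
  proof -
    have "(\<Sum>k=1..p-1. t k) = (\<Sum>i=1..h. t (2*i)) + (\<Sum>i=1..h. t (2*h + 1 - 2*i))"
      using sum_split_parity[of t h] by (simp add: p_eq)
    also have "(\<Sum>i=1..h. t (2*h + 1 - 2*i)) = - (\<Sum>i=1..h. (P - of_nat (2*i)) powi -3)"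
      unfolding t_def sum_negf[symmetric]
      by (intro sum.cong refl) (auto simp: p_eq of_nat_diff)
    finally show ?thesis by (simp add: evens_def t_def)
  qed
  also have "\<dots> \<simeq>\<^bsub>1\<^esub> evens (-3) - (\<Sum>i=1..h. - (of_nat (2*i) powi -3))"
    by (intro pcong_diff pcong_refl pcong_sum odd_term)
  also have "\<dots> = 2 * evens (-3)" by (simp add: evens_def sum_negf)
  also have "\<dots> \<simeq>\<^bsub>1\<^esub> 2 * (- bernoulli (p - 3) / 4)"
    by (intro pcong_mult_left evens_minus_3) simp
  finally have t_sum: "(\<Sum>k=1..p-1. t k) \<simeq>\<^bsub>1\<^esub> - bernoulli (p - 3) / 2" by simp
  have "of_nat (p choose k) ^ 3 = P^3 * - (t k * alt_choose (k - 1)^3)" if k: "k \<in> {1..p-1}" for k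
  proof -
    obtain l where l: "k = Suc l" using k by (cases k) auto
    have "k * (p choose k) = p * ((p - 1) choose l)"
      using binomial_absorption[of l p] by (simp add: l)
    from arg_cong[OF this, of "of_nat :: nat \<Rightarrow> rat"]
    have "of_nat k * of_nat (p choose k) = P * ((-1)^l * alt_choose l)"
      unfolding of_nat_mult choose_eq_alt_choose .
    then have "of_nat (p choose k) = P * ((-1)^l * alt_choose l) * inverse (of_nat k)"
      using k by (simp add: field_simps)
    then show ?thesis
      by (cases "even l")
         (simp_all add: l t_def power_mult_distrib power_int_minus power_inverse del: of_nat_Suc)
  qed
  moreover have "franel p = 2 + (\<Sum>k=1..p-1. (p choose k)^3)"
  proof -
    have "{0..p} = insert 0 (insert p {1..p-1})" "p \<notin> {1..p-1}" using gt_3 by auto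
    then show ?thesis using gt_3 by (simp add: franel_def)
  qed
  ultimately have "of_nat (franel p) = 2 + P^3 * - (\<Sum>k=1..p-1. t k * alt_choose (k - 1)^3)"
    by (simp add: sum_distrib_left sum_negf)
  also have "\<dots> \<simeq>\<^bsub>4\<^esub> 2 + P^3 * - (- bernoulli (p - 3) / 2)"
  proof -
    have "(\<Sum>k=1..p-1. t k * alt_choose (k - 1)^3) \<simeq>\<^bsub>1\<^esub> (\<Sum>k=1..p-1. t k * 1^3)"
    proof (intro pcong_sum pcong_mult_left pcong_power alt_choose_pcong_1)
      fix k assume "k \<in> {1..p-1}"
      then show "integral (t k)" "k - 1 < p"
        unfolding t_def by (auto intro!: integral_mult integral_power_int p_unit_less)
    qed auto
    then have "(\<Sum>k=1..p-1. t k * alt_choose (k - 1)^3) \<simeq>\<^bsub>1\<^esub> - bernoulli (p - 3) / 2"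
      using t_sum pcong_trans by simp
    then show ?thesis by (intro pcong_add pcong_refl pcong_scaleI[OF pcong_minus]) auto
  qed
  finally show ?thesis by simp
qed

text \<open>
  The logarithm of 1 + x up to third order, enough modulo p^4 for x divisible by p.
\<close>

definition trunc_log :: "rat \<Rightarrow> rat" where "trunc_log x = x - x^2 / 2 + x^3 / 3"

lemma pcong_0E:
  assumes "x \<simeq>\<^bsub>m\<^esub> 0" obtains y where "integral y" "x = P^m * y"
  using assms by (auto elim: pcongE)

text \<open>
  The functional equation of the logarithm: the difference is a polynomial in x and y all of whose
  terms have total degree at least 4.
\<close>

lemma trunc_log_mult:
  assumes "x \<simeq>\<^bsub>1\<^esub> 0" "y \<simeq>\<^bsub>1\<^esub> 0"
  shows "trunc_log ((1 + x) * (1 + y) - 1) \<simeq>\<^bsub>4\<^esub> trunc_log x + trunc_log y"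
proof -
  obtain X Y where X: "integral X" "x = P * X" and Y: "integral Y" "y = P * Y"
    using assms by (auto elim!: pcong_0E)
  \<comment> \<open>The quotient of the terms of degree at least 4 by p^4.\<close>
  define z where "z = X * Y * ((X + Y)^2 - X * Y / 2 + P * (X + Y) * X * Y + P^2 * X^2 * Y^2 / 3)"
  have "trunc_log ((1 + x) * (1 + y) - 1) = trunc_log x + trunc_log y + P^4 * z"
    by (simp add: trunc_log_def X Y z_def field_simps power2_eq_square power3_eq_cube power4_eq_xxxx)
  moreover have "integral z" unfolding z_def using X Y by auto
  ultimately show ?thesis by (rule pcongI)
qed

text \<open>
  A summand divisible by p^3 is seen only by the linear term.
\<close>

lemma trunc_log_add:
  assumes "x \<simeq>\<^bsub>1\<^esub> 0" "y \<simeq>\<^bsub>3\<^esub> 0"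
  shows "trunc_log (x + y) \<simeq>\<^bsub>4\<^esub> trunc_log x + y"
proof -
  obtain X Y where X: "integral X" "x = P * X" and Y: "integral Y" "y = P^3 * Y"
    using assms by (auto elim!: pcong_0E)
  define z where "z = Y * (- X - P^2 * Y / 2 + P * X^2 + P^3 * X * Y + P^5 * Y^2 / 3)"
  have "trunc_log (x + y) = trunc_log x + y + P^4 * z"
    by (simp add: trunc_log_def X Y z_def field_simps power2_eq_square power3_eq_cube power4_eq_xxxx
        eval_nat_numeral)
  moreover have "integral z" unfolding z_def using X Y by auto
  ultimately show ?thesis by (rule pcongI)
qed

lemma trunc_log_prod:
  assumes "finite I" "\<And>i. i \<in> I \<Longrightarrow> x i \<simeq>\<^bsub>1\<^esub> 0"
  shows "trunc_log ((\<Prod>i\<in>I. 1 + x i) - 1) \<simeq>\<^bsub>4\<^esub> (\<Sum>i\<in>I. trunc_log (x i))"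
  using assms
proof (induction I rule: finite_induct)
  case (insert i I)
  define y where "y = (\<Prod>i\<in>I. 1 + x i) - 1"
  have "(\<Prod>i\<in>I. 1 + x i) \<simeq>\<^bsub>1\<^esub> 1"
    using insert.prems pcong_add[OF pcong_refl[of 1]] by (intro pcong_prod_1) fastforce
  from pcong_diff[OF this pcong_refl[of 1]] have "y \<simeq>\<^bsub>1\<^esub> 0" by (simp add: y_def)
  with insert.prems have "trunc_log ((1 + x i) * (1 + y) - 1) \<simeq>\<^bsub>4\<^esub> trunc_log (x i) + trunc_log y"
    by (intro trunc_log_mult) auto
  also have "\<dots> \<simeq>\<^bsub>4\<^esub> trunc_log (x i) + (\<Sum>i\<in>I. trunc_log (x i))"
    unfolding y_def using insert by (intro pcong_add pcong_refl) auto
  finally show ?case using insert by (simp add: y_def)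
qed (simp add: trunc_log_def)

lemma prod_one_minus_P2:
  assumes "finite I" "\<And>i. i \<in> I \<Longrightarrow> integral (y i)"
  shows "(\<Prod>i\<in>I. 1 - P^2 * y i) \<simeq>\<^bsub>4\<^esub> 1 - P^2 * (\<Sum>i\<in>I. y i)"
  using assms
proof (induction I rule: finite_induct)
  case (insert i I)
  define s where "s = (\<Sum>i\<in>I. y i)"
  have "integral s" using insert unfolding s_def by auto
  have "(\<Prod>i\<in>insert i I. 1 - P^2 * y i) = (1 - P^2 * y i) * (\<Prod>i\<in>I. 1 - P^2 * y i)"
    using insert by simp
  also have "\<dots> \<simeq>\<^bsub>4\<^esub> (1 - P^2 * y i) * (1 - P^2 * s)"
    unfolding s_def using insert by (intro pcong_mult_left) auto
  also have "\<dots> \<simeq>\<^bsub>4\<^esub> 1 - P^2 * (y i + s)"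
    using \<open>integral s\<close> insert.prems
    by (intro pcongI[of _ _ _ "y i * s"])
       (auto simp: algebra_simps power2_eq_square power4_eq_xxxx)
  finally show ?case using insert by (simp add: s_def)
qed simp

definition half_prod :: rat where "half_prod = (\<Prod>i=1..h. 1 - P / of_nat (2*i))"

text \<open>
  Reversing the order of the numerators 2i - p turns half_prod into plus or minus the quotient of the
  odd numbers by the even numbers below p, that is, into the central binomial coefficient over 4^h.
\<close>

lemma alt_choose_half: "alt_choose h = 2^(p - 1) * half_prod"
proof -
  have p: "p - 1 = 2*h" using p_eq by simp
  have "half_prod = (\<Prod>i=1..h. (-1) * (of_nat (2*h + 1 - 2*i) / of_nat (2*i)))"
    unfolding half_prod_def by (intro prod.cong refl) (auto simp: p_eq of_nat_diff field_simps)
  also have "\<dots> = (-1)^h * ((\<Prod>i=1..h. of_nat (2*h + 1 - 2*i)) / (\<Prod>i=1..h. of_nat (2*i)))"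
    by (simp only: prod_dividef prod.distrib prod_constant card_atLeastAtMost) simp
  also have "(\<Prod>i=1..h. of_nat (2*h + 1 - 2*i)) = (\<Prod>i=1..h. of_nat (2*i - 1) :: rat)"
    by (rule prod.reindex_bij_witness[where i = "\<lambda>i. h + 1 - i" and j = "\<lambda>i. h + 1 - i"])
       (auto intro!: arg_cong[where f = of_nat])
  also have "\<dots> / (\<Prod>i=1..h. of_nat (2*i)) = (\<Prod>i=1..h. of_nat (2*i - 1) / of_nat (2*i))"
    by (simp add: prod_dividef)
  finally have "4^h * half_prod = (-1)^h * of_nat (2*h choose h)"
    by (simp add: central_binomial_prod)
  also have "\<dots> = alt_choose h"
    using choose_eq_alt_choose[of h] unfolding p by (simp flip: mult.assoc power_add)
  finally show ?thesis unfolding p by (simp add: power_mult)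
qed

lemma half_prod_nonzero: "half_prod \<noteq> 0"
  unfolding half_prod_def using p_eq by (auto simp: field_simps simp del: of_nat_mult)

text \<open>
  From (1 - p/i) = (1 - p/(2i))^2 (1 - p^2/(p - 2i)^2), the product over i gives a second relation between
  the middle binomial coefficient and half_prod, beside alt_choose_half.
\<close>

lemma two_power_eq: "2^(p - 1) = half_prod * (\<Prod>i=1..h. 1 - P^2 * (P - of_nat (2*i)) powi -2)"
proof -
  have identity: "1 - (y + 2 * x) / x = (1 - (y + 2 * x) / (2 * x))^2 * (1 - (y + 2 * x)^2 * inverse (y^2))"
    if "x \<noteq> 0" "y \<noteq> 0" for x y :: rat
    using that by (simp add: field_simps power2_eq_square)
  have "alt_choose h = (\<Prod>i=1..h. (1 - P / of_nat (2*i))^2 * (1 - P^2 * (P - of_nat (2*i)) powi -2))"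
    unfolding alt_choose_def
  proof (intro prod.cong refl)
    fix i assume "i \<in> {1..h}"
    then have i: "of_nat i \<noteq> (0::rat)" "2 * i < p" using p_eq by auto
    define x where "x = (of_nat i :: rat)"
    have "P - 2 * x \<noteq> 0" using i(2) unfolding x_def by (metis eq_iff_diff_eq_0 less_irrefl of_nat_eq_iff of_nat_mult of_nat_numeral)
    then have "1 - P / x = (1 - P / (2*x))^2 * (1 - P^2 * inverse ((P - 2 * x)^2))"
      using identity[of x "P - 2 * x"] i(1) by (simp add: x_def)
    then show "1 - P / of_nat i = (1 - P / of_nat (2*i))^2 * (1 - P^2 * (P - of_nat (2*i)) powi -2)"
      by (simp add: x_def power_int_minus)
  qed
  also have "\<dots> = half_prod * (half_prod * (\<Prod>i=1..h. 1 - P^2 * (P - of_nat (2*i)) powi -2))"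
    by (simp add: half_prod_def prod.distrib power2_eq_square)
  finally have "half_prod * 2^(p - 1) = half_prod * (half_prod * (\<Prod>i=1..h. 1 - P^2 * (P - of_nat (2*i)) powi -2))"
    unfolding alt_choose_half by (simp only: mult.commute)
  then show ?thesis using half_prod_nonzero by simp
qed

lemma integral_B: "integral (bernoulli (p - 3))"
  using integral_bernoulli[of "p - 3"] gt_3 by simp

lemma P_div_even_pcong_0: "i \<in> {1..h} \<Longrightarrow> P / of_nat (2*i) \<simeq>\<^bsub>1\<^esub> 0"
  by (rule P_div_pcong_0) (use p_eq in auto)

text \<open>
  By two_power_eq, since the product there is 1 - p^2 odds(-2) modulo p^4.
\<close>

lemma half_prod_pcong: "half_prod \<simeq>\<^bsub>4\<^esub> 2^(p - 1) + P^3 * (bernoulli (p - 3) / 12)"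
proof -
  define W where "W = (\<Prod>i=1..h. 1 - P^2 * (P - of_nat (2*i)) powi -2)"
  define b where "b = bernoulli (p - 3) / 12"
  have "integral b" using integral_B by (simp add: b_def)
  have "W \<simeq>\<^bsub>4\<^esub> 1 - P^2 * odds (-2)"
    unfolding W_def odds_def using p_eq
    by (intro prod_one_minus_P2 integral_power_int p_unit_diff) auto
  also have "\<dots> \<simeq>\<^bsub>4\<^esub> 1 - P^2 * (P * bernoulli (p - 3) / 12)"
    by (intro pcong_diff pcong_refl pcong_scaleI[OF odds_minus_2]) simp
  finally have "W \<simeq>\<^bsub>4\<^esub> 1 - P^3 * b"
    by (simp add: b_def power2_eq_square power3_eq_cube mult_ac)
  then have "W * (1 + P^3 * b) \<simeq>\<^bsub>4\<^esub> (1 - P^3 * b) * (1 + P^3 * b)"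
    using \<open>integral b\<close> by (intro pcong_mult) auto
  also have "\<dots> \<simeq>\<^bsub>4\<^esub> 1"
    using \<open>integral b\<close> by (intro pcongI[of _ _ _ "- (P^2 * b^2)"])
      (auto simp: algebra_simps power2_eq_square power3_eq_cube power4_eq_xxxx)
  finally have W: "1 \<simeq>\<^bsub>4\<^esub> W * (1 + P^3 * b)" by (rule pcong_sym)
  have "integral half_prod"
  proof (rule pcong_integral)
    show "half_prod \<simeq>\<^bsub>1\<^esub> 1"
      unfolding half_prod_def using pcong_diff[OF pcong_refl[of 1] P_div_even_pcong_0] by (intro pcong_prod_1) simp
  qed simp
  from pcong_mult_left[OF this W] have "half_prod \<simeq>\<^bsub>4\<^esub> 2^(p - 1) * (1 + P^3 * b)"
    unfolding two_power_eq W_def[symmetric] by (simp only: mult.assoc mult_1_right)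
  also have "\<dots> = 2^(p - 1) + P^3 * (b * 2^(p - 1))" by (simp add: algebra_simps)
  also have "\<dots> \<simeq>\<^bsub>4\<^esub> 2^(p - 1) + P^3 * (b * 1)"
    using \<open>integral b\<close> by (intro pcong_add pcong_refl pcong_scaleI[OF pcong_mult_left[OF _ fermat_2]]) auto
  finally show ?thesis by (simp add: b_def)
qed

text \<open>
  The polynomials 1, a, a^2 and L(a - 1), where L is trunc_log, form a basis of those of degree at most 3; fact
  cube is the expansion of a^3 in it. With T = 2^(p-1), the alternating sums of the four basis elements over
  a = alt_choose k are 1, T, T half_prod and, modulo p^4, L(half_prod - 1).
\<close>

lemma franel_p_minus_1: "of_nat (franel (p - 1)) \<simeq>\<^bsub>4\<^esub> 8^(p - 1) + P^3 * (5/8 * bernoulli (p - 3))"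
proof -
  have p: "p - 1 = 2*h" using p_eq by simp
  define T where "T = (2::rat)^(p - 1)"
  define b where "b = bernoulli (p - 3) / 12"
  have b: "integral b" "P^3 * b \<simeq>\<^bsub>3\<^esub> 0"
    using integral_B by (auto simp: b_def intro!: pcongI[of _ _ _ "bernoulli (p - 3) / 12"])
  have T: "T - 1 \<simeq>\<^bsub>1\<^esub> 0"
    using pcong_diff[OF fermat_2 pcong_refl[of 1]] by (simp add: T_def)
  have dT: "half_prod \<simeq>\<^bsub>4\<^esub> T + P^3 * b" using half_prod_pcong by (simp add: b_def T_def)
  have choose: "of_nat (2*h choose k) = (-1)^k * alt_choose k" for k
    using choose_eq_alt_choose[of k] by (simp only: p)
  have cube: "alt_choose k^3 = 11/2 - 9 * alt_choose k + 9/2 * alt_choose k^2 + 3 * trunc_log (alt_choose k - 1)" for k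
    by (simp add: trunc_log_def field_simps power2_eq_square power3_eq_cube)

  have s0: "(\<Sum>k\<le>2*h. (-1)^k) = (1::rat)"
    by (induction h) auto
  have s1: "(\<Sum>k\<le>2*h. (-1)^k * alt_choose k) = T"
  proof -
    have "(\<Sum>k\<le>2*h. (-1)^k * alt_choose k) = of_nat (\<Sum>k\<le>2*h. 2*h choose k)"
      by (simp add: choose)
    then show ?thesis unfolding choose_row_sum T_def p by simp
  qed
  have s2: "(\<Sum>k\<le>2*h. (-1)^k * alt_choose k^2) = T * half_prod"
  proof -
    have "(\<Sum>k\<le>2*h. (-1)^k * alt_choose k^2) = (\<Sum>k\<le>2*h. (-1)^k * of_nat (2*h choose k)^2)"
      by (simp add: choose power_mult_distrib flip: power_mult)
    also have "\<dots> = alt_choose h"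
      unfolding alternating_sum_choose_squared by (simp add: choose flip: mult.assoc power_add)
    finally show ?thesis by (simp add: alt_choose_half T_def)
  qed
  have "of_nat (franel (p - 1)) = (\<Sum>k\<le>2*h. (-1)^k * alt_choose k^3)"
    unfolding franel_def atLeast0AtMost p[symmetric] of_nat_sum of_nat_power choose_eq_alt_choose
    by (intro sum.cong refl) (simp add: power_mult_distrib power3_eq_cube)
  also have "\<dots> = 11/2 * (\<Sum>k\<le>2*h. (-1)^k) - 9 * (\<Sum>k\<le>2*h. (-1)^k * alt_choose k)
      + 9/2 * (\<Sum>k\<le>2*h. (-1)^k * alt_choose k^2) + 3 * (\<Sum>k\<le>2*h. (-1)^k * trunc_log (alt_choose k - 1))"
    unfolding cube sum_distrib_left sum.distrib[symmetric] sum_subtractf[symmetric]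
    by (intro sum.cong refl) (simp add: algebra_simps)
  also have "\<dots> = 11/2 - 9 * T + 9/2 * (T * half_prod) + 3 * (\<Sum>k\<le>2*h. (-1)^k * trunc_log (alt_choose k - 1))"
    unfolding s0 s1 s2 by simp
  also have "\<dots> \<simeq>\<^bsub>4\<^esub> 11/2 - 9 * T + 9/2 * (T * (T + P^3 * b)) + 3 * (trunc_log (T - 1) + P^3 * b)"
  proof (intro pcong_add pcong_refl pcong_mult_left dT)
    have "(\<Sum>k\<le>2*h. (-1)^k * trunc_log (alt_choose k - 1)) \<simeq>\<^bsub>4\<^esub> (\<Sum>k\<le>2*h. (-1)^k * (\<Sum>j=1..k. trunc_log (- P / of_nat j)))"
    proof (intro pcong_sum pcong_mult_left)
      fix k assume k: "k \<in> {..2*h}"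
      have "- P / of_nat j \<simeq>\<^bsub>1\<^esub> 0" if "j \<in> {1..k}" for j
      proof -
        have "0 < j" "j < p" using that k p_eq by auto
        from pcong_minus[OF P_div_pcong_0[OF this]] show ?thesis by simp
      qed
      from trunc_log_prod[of "{1..k}", OF _ this]
      show "trunc_log (alt_choose k - 1) \<simeq>\<^bsub>4\<^esub> (\<Sum>j=1..k. trunc_log (- P / of_nat j))"
        by (simp add: alt_choose_def)
    qed auto
    also have "\<dots> = (\<Sum>i=1..h. trunc_log (- P / of_nat (2*i)))"
      by (rule alternating_sum_partial_sums)
    also have "\<dots> \<simeq>\<^bsub>4\<^esub> trunc_log (half_prod - 1)"
    proof (rule pcong_sym)
      have "- P / of_nat (2*i) \<simeq>\<^bsub>1\<^esub> 0" if "i \<in> {1..h}" for i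
        using pcong_minus[OF P_div_even_pcong_0[OF that]] by simp
      from trunc_log_prod[of "{1..h}", OF _ this]
      show "trunc_log (half_prod - 1) \<simeq>\<^bsub>4\<^esub> (\<Sum>i=1..h. trunc_log (- P / of_nat (2*i)))" by (simp add: half_prod_def)
    qed
    also have "trunc_log (half_prod - 1) \<simeq>\<^bsub>4\<^esub> trunc_log ((T - 1) + P^3 * b)"
    proof -
      have "half_prod - 1 \<simeq>\<^bsub>4\<^esub> (T - 1) + P^3 * b"
        using pcong_diff[OF dT pcong_refl[of 1]] by (simp add: algebra_simps)
      moreover have "integral (T - 1 + P^3 * b)" using b by (auto simp: T_def)
      ultimately show ?thesis
        unfolding trunc_log_def divide_inverse
        by (intro pcong_add pcong_diff pcong_mult pcong_power) (auto simp: inverse_eq_divide)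
    qed
    also have "\<dots> \<simeq>\<^bsub>4\<^esub> trunc_log (T - 1) + P^3 * b"
      by (rule trunc_log_add[OF T b(2)])
    finally show "(\<Sum>k\<le>2*h. (-1)^k * trunc_log (alt_choose k - 1)) \<simeq>\<^bsub>4\<^esub> trunc_log (T - 1) + P^3 * b" .
  qed (auto simp: T_def)
  also have "\<dots> = T^3 + 3 * P^3 * b + 9/2 * P^3 * (b * T)"
    by (simp add: trunc_log_def field_simps power2_eq_square power3_eq_cube)
  also have "\<dots> = T^3 + 3 * P^3 * b + P^3 * (9/2 * b * T)" by simp
  also have "\<dots> \<simeq>\<^bsub>4\<^esub> T^3 + 3 * P^3 * b + P^3 * (9/2 * b * 1)"
    using b unfolding T_def
    by (intro pcong_add pcong_refl pcong_scaleI[OF pcong_mult_left[OF _ fermat_2]]) auto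
  also have "\<dots> = T^3 + P^3 * (5/8 * bernoulli (p - 3))" by (simp add: b_def algebra_simps)
  also have "T^3 = 8^(p - 1)" by (simp add: T_def eight_power_eq_cube)
  finally show ?thesis by simp
qed

end

section \<open>The three congruences\<close>

context prime_gt_3 begin

lemma rat_congI: "a \<simeq>\<^bsub>m\<^esub> b \<Longrightarrow> integral b \<Longrightarrow> rat_cong p m a b"
  unfolding rat_cong_def using pcong_integral by (simp add: pcong_def)

lemma eight_power_pcong_1: "8 ^ (p - 1) \<simeq>\<^bsub>1\<^esub> 1"
  using pcong_power[OF fermat_2, of 3] by (simp add: eight_power_eq_cube)

text \<open>
  The values of the two Franel numbers inserted into the quadratic form. The factor p^4 leaves only their residues
  modulo p^2; the terms in p^2 f_p f_(p-1) are the only source of the Bernoulli number.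
\<close>

lemma franel_form_pcong:
  fixes a b0 b1 b2 c :: rat
  defines "x \<equiv> of_nat (franel p)" and "y \<equiv> of_nat (franel (p - 1))"
    and "E \<equiv> 8 ^ (p - 1)" and "B \<equiv> bernoulli (p - 3)"
  assumes "integral a" "integral b0" "integral b1" "integral b2" "integral c"
  shows "a * P^4 * x^2 + P^2 * (b0 + b1 * P + b2 * P^2) * x * y + c * P^4 * y^2
    \<simeq>\<^bsub>6\<^esub> P^4 * (4 * a + 2 * b2 * E + c * E^2) + P^2 * (b0 * (2 * E + P^3 * (7/4 * B))) + P^3 * (b1 * (2 * E))"
proof -
  have int: "integral B" "integral E" using integral_B by (auto simp: B_def E_def)
  \<comment> \<open>The Bernoulli terms matter only modulo p^4.\<close>
  have drop: "u \<simeq>\<^bsub>3\<^esub> v" if "u \<simeq>\<^bsub>4\<^esub> v + P^3 * w" "integral w" for u v w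
  proof -
    have "u \<simeq>\<^bsub>3\<^esub> v + P^3 * w" using that(1) by (rule pcong_weaken) simp
    also have "\<dots> \<simeq>\<^bsub>3\<^esub> v" using that(2) by (intro pcongI) auto
    finally show ?thesis .
  qed
  have "x * y \<simeq>\<^bsub>4\<^esub> (2 + P^3 * (B / 2)) * (E + P^3 * (5/8 * B))"
    unfolding x_def y_def using franel_p franel_p_minus_1 int
    by (intro pcong_mult) (auto simp: B_def E_def)
  also have "\<dots> = 2 * E + P^3 * (5/4 * B + B / 2 * E) + P^4 * (P^2 * (5/16 * B^2))"
    by (simp add: field_simps eval_nat_numeral)
  also have "\<dots> \<simeq>\<^bsub>4\<^esub> 2 * E + P^3 * (5/4 * B + B / 2 * E)"
    by (rule pcongI[OF refl]) (use int in auto)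
  also have "\<dots> \<simeq>\<^bsub>4\<^esub> 2 * E + P^3 * (5/4 * B + B / 2 * 1)"
    using int unfolding E_def
    by (intro pcong_add pcong_refl pcong_scaleI[OF pcong_add[OF pcong_refl pcong_mult_left[OF _ eight_power_pcong_1]]]) auto
  finally have xy: "x * y \<simeq>\<^bsub>4\<^esub> 2 * E + P^3 * (7/4 * B)" by simp
  have xy3: "x * y \<simeq>\<^bsub>3\<^esub> 2 * E" using drop[OF xy] int by simp
  have x3: "x \<simeq>\<^bsub>3\<^esub> 2" using drop[OF franel_p] int by (simp add: x_def B_def)
  have y3: "y \<simeq>\<^bsub>3\<^esub> E" using drop[OF franel_p_minus_1] int by (simp add: y_def E_def B_def)
  have "a * x^2 + b2 * (x * y) + c * y^2 \<simeq>\<^bsub>2\<^esub> a * 2^2 + b2 * (2 * E) + c * E^2"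
    using assms(5-) int
    by (intro pcong_weaken[of _ 3 _ 2] pcong_add pcong_mult_left pcong_power xy3 x3 y3) auto
  then have "P^4 * (a * x^2 + b2 * (x * y) + c * y^2) + P^2 * (b0 * (x * y)) + P^3 * (b1 * (x * y))
    \<simeq>\<^bsub>6\<^esub> P^4 * (a * 2^2 + b2 * (2 * E) + c * E^2) + P^2 * (b0 * (2 * E + P^3 * (7/4 * B))) + P^3 * (b1 * (2 * E))"
    using pcong_mult_left[OF \<open>integral b0\<close> xy] pcong_mult_left[OF \<open>integral b1\<close> xy3]
    by (intro pcong_add) (auto elim: pcong_scaleI)
  moreover have "P^4 * (a * x^2 + b2 * (x * y) + c * y^2) + P^2 * (b0 * (x * y)) + P^3 * (b1 * (x * y))
      = a * P^4 * x^2 + P^2 * (b0 + b1 * P + b2 * P^2) * x * y + c * P^4 * y^2"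
    by (simp add: algebra_simps eval_nat_numeral)
  ultimately show ?thesis by (simp add: mult_ac)
qed

lemma P5_scale: "u \<simeq>\<^bsub>1\<^esub> v \<Longrightarrow> P^5 * u \<simeq>\<^bsub>6\<^esub> P^5 * v"
  by (rule pcong_scaleI) auto

lemma Suc_p_minus_1: "Suc (p - 1) = p"
  using gt_3 by simp

text \<open>
  Multiplying by (-8)^(p-1) = E clears the denominators. With T = 2^(p-1) = 1 + p q and E = T^3, the
  coefficients of p^4 on both sides then differ by a multiple of (p q)^3, hence agree modulo p^2.
\<close>

lemma franel_congruence_minus_8:
  "(\<Sum>n\<le>p - 1. (27 * (2 * of_nat n + 1)^3 + 13 * (2 * of_nat n + 1)) * (of_nat (franel n)^2 / (-8)^n))
   \<simeq>\<^bsub>6\<^esub> - 8 * P^2 + 48 * P^4 + 96 * P^4 * (2^(p - 1) - 1) - 7 * P^5 * bernoulli (p - 3)"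
    (is "?S \<simeq>\<^bsub>6\<^esub> ?R")
proof -
  define E :: rat where "E = 8^(p - 1)"
  define T :: rat where "T = 2^(p - 1)"
  define B where "B = bernoulli (p - 3)"
  note defs = E_def[symmetric] T_def[symmetric] B_def[symmetric]
  have int: "integral B" using integral_B by (simp add: B_def)
  have E: "E = T^3" by (simp add: T_def E_def eight_power_eq_cube)
  obtain q where q: "integral q" "T = 1 + P * q"
    using fermat_2 by (auto simp: T_def elim: pcongE)
  have unit: "p_unit E" unfolding E_def by (rule p_unit_8_power)
  have sign: "(-8::rat)^(p - 1) = E" using p_eq by (simp add: E_def)
  have "E * ?S = (-8/3) * P^4 * of_nat (franel p)^2
      + P^2 * (-4 + 0 * P + 56/3 * P^2) * of_nat (franel p) * of_nat (franel (p - 1))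
      + 64/3 * P^4 * of_nat (franel (p - 1))^2"
    using franel_square_sum_minus_8[of "p - 1"]
    by (simp only: Suc_p_minus_1 sign times_divide_eq_right mult.commute[of E] mult_zero_left add_0_right)
  also have "\<dots> \<simeq>\<^bsub>6\<^esub> P^4 * (4 * (-8/3) + 2 * (56/3) * E + 64/3 * E^2)
      + P^2 * (-4 * (2 * E + P^3 * (7/4 * B))) + P^3 * (0 * (2 * E))"
    unfolding E_def B_def by (rule franel_form_pcong) auto
  also have "\<dots> = P^4 * (4 * (-8/3) + 2 * (56/3) * E + 64/3 * E^2) + - 8 * P^2 * E + P^5 * (-7 * B)"
    by (simp add: field_simps eval_nat_numeral)
  also have "\<dots> \<simeq>\<^bsub>6\<^esub> P^4 * (E * (48 + 96 * (T - 1))) + - 8 * P^2 * E + P^5 * (-7 * B * E)"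
  proof (intro pcong_add pcong_refl P5_scale)
    \<comment> \<open>The difference 128 s^3 + 224 s^4 + 128 s^5 + 64/3 s^6 at s = p q, divided by p^2.\<close>
    define c where "c = 128 * P * q^3 + 224 * P^2 * q^4 + 128 * P^3 * q^5 + 64/3 * P^4 * q^6"
    have "4 * (-8/3) + 2 * (56/3) * E + 64/3 * E^2 = E * (48 + 96 * (T - 1)) + P^2 * c"
      unfolding E q(2) c_def by (simp add: field_simps eval_nat_numeral)
    then have "4 * (-8/3) + 2 * (56/3) * E + 64/3 * E^2 \<simeq>\<^bsub>2\<^esub> E * (48 + 96 * (T - 1))"
      by (rule pcongI) (use q(1) in \<open>auto simp: c_def\<close>)
    then show "P^4 * (4 * (-8/3) + 2 * (56/3) * E + 64/3 * E^2)
        \<simeq>\<^bsub>6\<^esub> P^4 * (E * (48 + 96 * (T - 1)))"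
      by (rule pcong_scaleI) simp
    show "- 7 * B \<simeq>\<^bsub>1\<^esub> - 7 * B * E"
      using pcong_mult_left[OF _ pcong_sym[OF eight_power_pcong_1], of "-7 * B"] int by (simp add: E_def)
  qed
  also have "\<dots> = E * ?R" unfolding defs by (simp add: algebra_simps eval_nat_numeral)
  finally show ?thesis by (rule pcong_cancel[OF unit])
qed

lemma franel_congruence_1:
  "(\<Sum>n\<le>p - 1. (2646 * of_nat n ^ 3 + 5103 * of_nat n ^ 2 + 3668 * of_nat n + 940) * of_nat (franel n) ^ 2)
   \<simeq>\<^bsub>6\<^esub> 32 * P^2 * (21 * P - 10) * 8^(p - 1) + 196 * P^4 * (3 + 8 * (8^(p - 1) - 1))
      - 280 * P^5 * bernoulli (p - 3)"
    (is "?S \<simeq>\<^bsub>6\<^esub> ?R")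
proof -
  define E :: rat where "E = 8^(p - 1)"
  define B where "B = bernoulli (p - 3)"
  note defs = E_def[symmetric] B_def[symmetric]
  obtain e where e: "integral e" "E = 1 + P * e"
    using eight_power_pcong_1 by (auto simp: E_def elim: pcongE)
  have "?S = 49/3 * P^4 * of_nat (franel p)^2
      + P^2 * (-160 + 336 * P + (-784/3) * P^2) * of_nat (franel p) * of_nat (franel (p - 1))
      + 3136/3 * P^4 * of_nat (franel (p - 1))^2"
    unfolding franel_square_sum_1 Suc_p_minus_1 by simp
  also have "\<dots> \<simeq>\<^bsub>6\<^esub> P^4 * (4 * (49/3) + 2 * (-784/3) * E + 3136/3 * E^2)
      + P^2 * (-160 * (2 * E + P^3 * (7/4 * B))) + P^3 * (336 * (2 * E))"
    unfolding E_def B_def by (rule franel_form_pcong) auto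
  also have "\<dots> \<simeq>\<^bsub>6\<^esub> P^4 * (196 * (3 + 8 * (E - 1)))
      + P^2 * (-160 * (2 * E + P^3 * (7/4 * B))) + P^3 * (336 * (2 * E))"
  proof (intro pcong_add pcong_refl)
    have "4 * (49/3) + 2 * (-784/3) * E + 3136/3 * E^2 = 196 * (3 + 8 * (E - 1)) + P^2 * (3136/3 * e^2)"
      unfolding e(2) by (simp add: field_simps eval_nat_numeral)
    then have "4 * (49/3) + 2 * (-784/3) * E + 3136/3 * E^2 \<simeq>\<^bsub>2\<^esub> 196 * (3 + 8 * (E - 1))"
      by (rule pcongI) (use e(1) in auto)
    then show "P^4 * (4 * (49/3) + 2 * (-784/3) * E + 3136/3 * E^2)
        \<simeq>\<^bsub>6\<^esub> P^4 * (196 * (3 + 8 * (E - 1)))"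
      by (rule pcong_scaleI) simp
  qed
  also have "\<dots> = ?R" unfolding defs by (simp add: algebra_simps eval_nat_numeral)
  finally show ?thesis .
qed

text \<open>
  Multiplying by 64^(p-1) = E^2, where E = 8^(p-1), clears the denominators; the factor 8^(1-p) on the
  right is 1/E.
\<close>

lemma franel_congruence_64:
  "(\<Sum>n\<le>p - 1. (7938 * of_nat n ^ 3 + 8505 * of_nat n ^ 2 + 4200 * of_nat n + 813)
      * (of_nat (franel n) ^ 2 / 64 ^ n))
   \<simeq>\<^bsub>6\<^esub> 245 * P^4 - 392 * P^4 * (8^(p - 1) - 1)
      + 4 * P^2 * (49 * P^2 + 63 * P + 30) * 8 powi (1 - int p) + 105 * P^5 * bernoulli (p - 3)"
    (is "?S \<simeq>\<^bsub>6\<^esub> ?R")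
proof -
  define E :: rat where "E = 8^(p - 1)"
  define B where "B = bernoulli (p - 3)"
  note defs = E_def[symmetric] B_def[symmetric]
  have int: "integral B" using integral_B by (simp add: B_def)
  obtain e where e: "integral e" "E = 1 + P * e"
    using eight_power_pcong_1 by (auto simp: E_def elim: pcongE)
  have unit: "p_unit E" unfolding E_def by (rule p_unit_8_power)
  have square: "(64::rat)^(p - 1) = E^2"
    by (simp add: E_def power_mult[symmetric] mult.commute[of _ 2]) (simp add: power_mult)
  have "8 powi (1 - int p) = inverse E"
    using gt_3 by (simp add: E_def power_int_minus[symmetric] flip: power_int_of_nat)
  then have inv: "E^2 * (8 powi (1 - int p)) = E"
    using p_unit_imp_nonzero[OF unit] by (simp add: power2_eq_square)
  have "E^2 * ?S = 49 * P^4 * of_nat (franel p)^2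
      + P^2 * (60 + 126 * P + 98 * P^2) * of_nat (franel p) * of_nat (franel (p - 1))
      + 49 * P^4 * of_nat (franel (p - 1))^2"
    using franel_square_sum_64[of "p - 1"]
    by (simp only: Suc_p_minus_1 square times_divide_eq_right mult.commute[of "E^2"])
  also have "\<dots> \<simeq>\<^bsub>6\<^esub> P^4 * (4 * 49 + 2 * 98 * E + 49 * E^2)
      + P^2 * (60 * (2 * E + P^3 * (7/4 * B))) + P^3 * (126 * (2 * E))"
    unfolding E_def B_def by (rule franel_form_pcong) auto
  also have "\<dots> = P^4 * (4 * 49 + 2 * 98 * E + 49 * E^2)
      + P^2 * (120 * E) + P^3 * (252 * E) + P^5 * (105 * B * 1)"
    by (simp add: field_simps eval_nat_numeral)
  also have "\<dots> \<simeq>\<^bsub>6\<^esub> P^4 * (E^2 * (245 - 392 * (E - 1)) + 196 * E)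
      + P^2 * (120 * E) + P^3 * (252 * E) + P^5 * (105 * B * E^2)"
  proof (intro pcong_add pcong_refl P5_scale)
    have "4 * 49 + 2 * 98 * E + 49 * E^2
        = E^2 * (245 - 392 * (E - 1)) + 196 * E + P^2 * (588 * e^2 + 392 * P * e^3)"
      unfolding e(2) by (simp add: field_simps eval_nat_numeral)
    then have "4 * 49 + 2 * 98 * E + 49 * E^2 \<simeq>\<^bsub>2\<^esub> E^2 * (245 - 392 * (E - 1)) + 196 * E"
      by (rule pcongI) (use e(1) in auto)
    then show "P^4 * (4 * 49 + 2 * 98 * E + 49 * E^2)
        \<simeq>\<^bsub>6\<^esub> P^4 * (E^2 * (245 - 392 * (E - 1)) + 196 * E)"
      by (rule pcong_scaleI) simp
    show "105 * B * 1 \<simeq>\<^bsub>1\<^esub> 105 * B * E^2"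
      using pcong_power[OF eight_power_pcong_1, of 2] int
      unfolding E_def by (intro pcong_mult_left[OF _ pcong_sym]) auto
  qed
  also have "\<dots> = E^2 * (245 * P^4 - 392 * P^4 * (E - 1) + 105 * P^5 * B)
      + 4 * P^2 * (49 * P^2 + 63 * P + 30) * E"
    by (simp add: field_simps eval_nat_numeral)
  also have "\<dots> = E^2 * (245 * P^4 - 392 * P^4 * (E - 1) + 105 * P^5 * B)
      + 4 * P^2 * (49 * P^2 + 63 * P + 30) * (E^2 * (8 powi (1 - int p)))"
    unfolding inv ..
  also have "\<dots> = E^2 * ?R"
    unfolding defs by (simp add: algebra_simps eval_nat_numeral)
  finally show ?thesis by (rule pcong_cancel[OF p_unit_power[OF unit]])
qed

end

theorem theorem4p6:
  fixes p :: nat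
  assumes "prime p" and "p > 3"
  shows "rat_cong p 6
           (\<Sum>n=0..p-1. (27 * (2 * of_nat n + 1) ^ 3 + 13 * (2 * of_nat n + 1))
              * (of_nat (franel n) ^ 2 / (-8) ^ n))
           (- 8 * of_nat p ^ 2 + 48 * of_nat p ^ 4 + 96 * of_nat p ^ 4 * (2 ^ (p - 1) - 1)
              - 7 * of_nat p ^ 5 * bernoulli (p - 3))
       \<and> rat_cong p 6
           (\<Sum>n=0..p-1. (2646 * of_nat n ^ 3 + 5103 * of_nat n ^ 2 + 3668 * of_nat n + 940)
              * of_nat (franel n) ^ 2)
           (32 * of_nat p ^ 2 * (21 * of_nat p - 10) * 8 ^ (p - 1)
              + 196 * of_nat p ^ 4 * (3 + 8 * (8 ^ (p - 1) - 1))
              - 280 * of_nat p ^ 5 * bernoulli (p - 3))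
       \<and> rat_cong p 6
           (\<Sum>n=0..p-1. (7938 * of_nat n ^ 3 + 8505 * of_nat n ^ 2 + 4200 * of_nat n + 813)
              * (of_nat (franel n) ^ 2 / 64 ^ n))
           (245 * of_nat p ^ 4 - 392 * of_nat p ^ 4 * (8 ^ (p - 1) - 1)
              + 4 * of_nat p ^ 2 * (49 * of_nat p ^ 2 + 63 * of_nat p + 30) * 8 powi (1 - int p)
              + 105 * of_nat p ^ 5 * bernoulli (p - 3))"
proof -
  have "odd p" using assms prime_odd_nat[of p] by simp
  then obtain h where "p = 2 * h + 1" by (rule oddE)
  then interpret prime_gt_3 p h using assms by unfold_locales
  have "integral (8 powi (1 - int p))"
    using p_unit_8_power[of 1] by (intro integral_power_int) simp
  then show ?thesis
    unfolding atLeast0AtMost using integral_B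
    by (intro conjI rat_congI franel_congruence_minus_8 franel_congruence_1 franel_congruence_64) auto
qed

end
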